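(* Let $n\ge1$, $\alpha=\pi/(2n+1)$, and let $\Gamma$ be the exchange graph of the initial seed $(\mathbf v_0,B_0)$. Then $\Gamma$ is quasi-isometric to the Cayley graph of the translation lattice $L$ (with respect to a finite symmetric generating set), and a quasi-isometry is given by the translation of the initial seed, i.e. by the map $$L\to\Gamma,\qquad w\mapsto w+(\mathbf v_0,B_0).$$
   Context: **Exchange matrices.** An exchange matrix is a real skew-symmetric $3\times3$ matrix $B=(b_{ij})$, identified with the quiver on $\{1,2,3\}$ having an arrow $i\to j$ of weight $b_{ij}$ whenever $b_{ij}>0$; it is acyclic if this quiver has no oriented cycle, cyclic otherwise. The mutation $\mu_k(B)=(b'_{ij})$ is given by $b'_{ij}=-b_{ij}$ if $k\in\{i,j\}$ and $b'_{ij}=b_{ij}+(b_{ik}|b_{kj}|+|b_{ik}|b_{kj})/2$ otherwise. **Seeds in $\mathbb E^2$.** Let $V$ be the space of affine functions $f(x)=\langle a,x\rangle+c$ on the Euclidean plane $\mathbb E^2$ with the form $(f,g)=\langle a,a'\rangle$ for $g(x)=\langle a',x\rangle+c'$; for non-constant $f$ put $\Pi_f=\{f<0\}$, $l_f=\{f=0\}$. A geometric realisation of $B$ is a basis $\mathbf v=(v_1,v_2,v_3)$ of $V$ with $(v_i,v_i)=2$, $|(v_i,v_j)|=|b_{ij}|$ for $i\neq j$, and such that, if all $(v_i,v_j)\ne0$, the number of pairs $i<j$ with $(v_i,v_j)>0$ is even if $B$ is acyclic and odd otherwise. A seed is a pair $(\mathbf v,B)$ up to simultaneous permutation of indices. It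 is represented by the domain $\Pi_{v_1}\cap\Pi_{v_2}\cap\Pi_{v_3}$, a triangle or an infinite region bounded by two parallel half-lines and a segment, together with the quiver of $B$, whose vertices are the sides (weights are $2\cos$ of the angle between the corresponding lines). **Mutation.** Given a notion of positive/negative vectors ($v$ negative iff $-v$ positive), $\mu_k(\mathbf v,B)=(\mathbf v',\mu_k(B))$ with $v_k'=-v_k$ and, for $i\ne k$: if $v_k$ is positive, $v_i'=v_i$ when $b_{ik}>0$ and $v_i'=v_i-(v_i,v_k)v_k$ when $b_{ik}<0$; if $v_k$ is negative, $v_i'=v_i$ when $b_{ik}<0$ and $v_i'=v_i-(v_i,v_k)v_k$ when $b_{ik}>0$. The exchange graph of a seed has as vertices all seeds obtained from it by mutations; edges join seeds related by one mutation; it carries the graph metric. **Initial seed.** The initial triangle $\Delta_0$ is an isosceles triangle $XYZ$ with angle $n\alpha$ at $X$ and at $Y$ and angle $\alpha$ at $Z$. The initial seed $(\mathbf v_0,B_0)$ is given by $\Delta_0$ with the quiver having arrows $XY\to XZ$, $XY\to YZ$, $XZ\to YZ$ (source $XY$, sink $YZ$). The belt line $b$ is the line through the feet of the altitudes of $\Delta_0$ on the sides $XY$ and $YZ$. The reference point $u$ lies infinitely far away on $b$, in the direction from the foot on the source to the foot on the sink: $v$ is positive iff all points of $b$ sufficiently far in this direction lie in $\Pi_v$. **Translation lattice.** For a vector $w$, $w+(\mathbf v,B)$ is the seed with domain translated by $w$ and the same quiver. $L$ is the $\mathbb Z$-module generated by all vectors $w$ such that $\Gamma$ contains two seeds differing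 by translation by $w$ (all such $w$ are parallel to $b$, so $L$ may be identified with the module generated by their lengths). *)

theory Defs
  imports "HOL-Analysis.Analysis" "HOL-Computational_Algebra.Group_Closure"
begin

section \<open>Exchange matrices\<close>

definition exchange_matrix :: "real^3^3 \<Rightarrow> bool" where
  "exchange_matrix B \<longleftrightarrow> transpose B = - B"

definition acyclic_quiver :: "real^3^3 \<Rightarrow> bool" where
  "acyclic_quiver B \<longleftrightarrow> acyclic {(i, j). B $ i $ j > 0}"

definition mutate_matrix :: "3 \<Rightarrow> real^3^3 \<Rightarrow> real^3^3" where
  "mutate_matrix k B = (\<chi> i j.
     if k = i \<or> k = j then - (B $ i $ j)
     else B $ i $ j + (B $ i $ k * \<bar>B $ k $ j\<bar> + \<bar>B $ i $ k\<bar> * B $ k $ j) / 2)"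


section \<open>Affine functions on the Euclidean plane\<close>

text \<open>The pair \<open>(a, c)\<close> encodes the affine function \<open>x \<mapsto> a \<bullet> x + c\<close>; the vector space
  structure of the product type is then the pointwise one.\<close>

type_synonym afun = "(real^2) \<times> real"

definition aeval :: "afun \<Rightarrow> real^2 \<Rightarrow> real" where
  "aeval f x = fst f \<bullet> x + snd f"

definition form :: "afun \<Rightarrow> afun \<Rightarrow> real" where
  "form f g = fst f \<bullet> fst g"

definition half_plane :: "afun \<Rightarrow> (real^2) set" where
  "half_plane f = {x. aeval f x < 0}"

definition zero_line :: "afun \<Rightarrow> (real^2) set" where
  "zero_line f = {x. aeval f x = 0}"


section \<open>Seeds\<close>

text \<open>In the index type \<open>3\<close> the numerals \<open>3\<close> and \<open>0\<close> coincide, so its order is \<open>3 < 1 < 2\<close>.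
  As the form is symmetric, the count of pairs below does not depend on the order chosen.\<close>

definition geometric_realisation :: "afun^3 \<Rightarrow> real^3^3 \<Rightarrow> bool" where
  "geometric_realisation v B \<longleftrightarrow>
     inj (($) v) \<and> independent (range (($) v)) \<and> span (range (($) v)) = UNIV \<and>
     (\<forall>i. form (v $ i) (v $ i) = 2) \<and>
     (\<forall>i j. i \<noteq> j \<longrightarrow> \<bar>form (v $ i) (v $ j)\<bar> = \<bar>B $ i $ j\<bar>) \<and>
     ((\<forall>i j. form (v $ i) (v $ j) \<noteq> 0) \<longrightarrow>
        (even (card {(i, j). i < j \<and> form (v $ i) (v $ j) > 0}) \<longleftrightarrow> acyclic_quiver B))"

type_synonym labelled_seed = "(afun^3) \<times> (real^3^3)"

definition is_labelled_seed :: "labelled_seed \<Rightarrow> bool" where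
  "is_labelled_seed s \<longleftrightarrow> exchange_matrix (snd s) \<and> geometric_realisation (fst s) (snd s)"

definition relabel :: "(3 \<Rightarrow> 3) \<Rightarrow> labelled_seed \<Rightarrow> labelled_seed" where
  "relabel \<sigma> s = (\<chi> i. fst s $ \<sigma> i, \<chi> i j. snd s $ \<sigma> i $ \<sigma> j)"

text \<open>A seed is the class of a labelled seed under simultaneous permutation of the indices.\<close>

type_synonym seed = "labelled_seed set"

definition seed_of :: "labelled_seed \<Rightarrow> seed" where
  "seed_of s = {relabel \<sigma> s | \<sigma>. bij \<sigma>}"

definition seed_domain :: "labelled_seed \<Rightarrow> (real^2) set" where
  "seed_domain s = (\<Inter>i. half_plane (fst s $ i))"


section \<open>Mutation and the exchange graph\<close>

text \<open>Everything here is relative to a predicate \<open>pos\<close> singling out the positive vectors;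
  \<open>f\<close> is negative iff \<open>pos (- f)\<close>. A seed is mutated at \<open>k\<close> only if its \<open>k\<close>-th vector is
  positive or negative. If \<open>b\<^sub>i\<^sub>k = 0\<close>, the \<open>i\<close>-th vector is kept; for a
  geometric realisation \<open>(v\<^sub>i, v\<^sub>k) = 0\<close> in this case, so both formulas agree.\<close>

definition mutate_vectors :: "(afun \<Rightarrow> bool) \<Rightarrow> 3 \<Rightarrow> afun^3 \<Rightarrow> real^3^3 \<Rightarrow> afun^3" where
  "mutate_vectors pos k v B = (\<chi> i.
     if i = k then - (v $ k)
     else if pos (v $ k) \<and> B $ i $ k < 0 \<or> pos (- (v $ k)) \<and> B $ i $ k > 0
       then v $ i - form (v $ i) (v $ k) *\<^sub>R (v $ k)
     else v $ i)"

definition mutation :: "(afun \<Rightarrow> bool) \<Rightarrow> 3 \<Rightarrow> labelled_seed \<Rightarrow> labelled_seed \<Rightarrow> bool" where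
  "mutation pos k s t \<longleftrightarrow>
     (pos (fst s $ k) \<or> pos (- (fst s $ k))) \<and>
     t = (mutate_vectors pos k (fst s) (snd s), mutate_matrix k (snd s))"

definition seed_mutations :: "(afun \<Rightarrow> bool) \<Rightarrow> (seed \<times> seed) set" where
  "seed_mutations pos = {(seed_of s, seed_of t) | s t. \<exists>k. mutation pos k s t}"

definition exchange_vertices :: "(afun \<Rightarrow> bool) \<Rightarrow> labelled_seed \<Rightarrow> seed set" where
  "exchange_vertices pos s = {C. (seed_of s, C) \<in> (seed_mutations pos)\<^sup>*}"

definition exchange_edges :: "(afun \<Rightarrow> bool) \<Rightarrow> labelled_seed \<Rightarrow> (seed \<times> seed) set" where
  "exchange_edges pos s =
     {(C, D). C \<in> exchange_vertices pos s \<and> D \<in> exchange_vertices pos s \<and>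
              ((C, D) \<in> seed_mutations pos \<or> (D, C) \<in> seed_mutations pos)}"


section \<open>The initial seed and the reference point\<close>

definition angle_at :: "real^2 \<Rightarrow> real^2 \<Rightarrow> real^2 \<Rightarrow> real" where
  "angle_at A P Q = arccos ((P - A) \<bullet> (Q - A) / (norm (P - A) * norm (Q - A)))"

definition initial_triangle :: "nat \<Rightarrow> real \<Rightarrow> real^2 \<Rightarrow> real^2 \<Rightarrow> real^2 \<Rightarrow> bool" where
  "initial_triangle n \<alpha> X Y Z \<longleftrightarrow>
     \<not> collinear {X, Y, Z} \<and>
     angle_at X Y Z = real n * \<alpha> \<and> angle_at Y X Z = real n * \<alpha> \<and> angle_at Z X Y = \<alpha>"

text \<open>The sides \<open>XY\<close>, \<open>XZ\<close>, \<open>YZ\<close> carry the indices 1, 2, 3. The weights of the quiver need not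
  be prescribed, since a geometric realisation determines the absolute values of the entries.\<close>

definition initial_seed :: "real^2 \<Rightarrow> real^2 \<Rightarrow> real^2 \<Rightarrow> labelled_seed \<Rightarrow> bool" where
  "initial_seed X Y Z s \<longleftrightarrow>
     is_labelled_seed s \<and>
     zero_line (fst s $ 1) = affine hull {X, Y} \<and>
     zero_line (fst s $ 2) = affine hull {X, Z} \<and>
     zero_line (fst s $ 3) = affine hull {Y, Z} \<and>
     seed_domain s = interior (convex hull {X, Y, Z}) \<and>
     snd s $ 1 $ 2 > 0 \<and> snd s $ 1 $ 3 > 0 \<and> snd s $ 2 $ 3 > 0"

definition altitude_foot :: "real^2 \<Rightarrow> real^2 \<Rightarrow> real^2 \<Rightarrow> real^2 \<Rightarrow> bool" where
  "altitude_foot F P A B \<longleftrightarrow> F \<in> affine hull {A, B} \<and> orthogonal (P - F) (B - A)"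

text \<open>Positivity with respect to the point at infinity of the line through \<open>F\<close> and \<open>G\<close>, in the
  direction from \<open>F\<close> to \<open>G\<close>.\<close>

definition positive_towards :: "real^2 \<Rightarrow> real^2 \<Rightarrow> afun \<Rightarrow> bool" where
  "positive_towards F G f \<longleftrightarrow> (\<forall>\<^sub>F t in at_top. F + t *\<^sub>R (G - F) \<in> half_plane f)"


section \<open>Translations\<close>

text \<open>Translating a domain by \<open>w\<close> replaces each bounding function \<open>f\<close> by \<open>x \<mapsto> f (x - w)\<close>.\<close>

definition translate_afun :: "real^2 \<Rightarrow> afun \<Rightarrow> afun" where
  "translate_afun w f = (fst f, snd f - fst f \<bullet> w)"

definition translate_labelled :: "real^2 \<Rightarrow> labelled_seed \<Rightarrow> labelled_seed" where
  "translate_labelled w s = (\<chi> i. translate_afun w (fst s $ i), snd s)"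

definition translate_seed :: "real^2 \<Rightarrow> seed \<Rightarrow> seed" where
  "translate_seed w C = translate_labelled w ` C"

definition translation_lattice :: "(afun \<Rightarrow> bool) \<Rightarrow> labelled_seed \<Rightarrow> (real^2) set" where
  "translation_lattice pos s =
     group_closure {w. \<exists>C \<in> exchange_vertices pos s. translate_seed w C \<in> exchange_vertices pos s}"


section \<open>Graph metrics, Cayley graphs and quasi-isometries\<close>

text \<open>Only meaningful for two vertices joined by a path.\<close>

definition graph_dist :: "('a \<times> 'a) set \<Rightarrow> 'a \<Rightarrow> 'a \<Rightarrow> real" where
  "graph_dist E x y = real (LEAST m. (x, y) \<in> E ^^ m)"

definition finite_symmetric_generators :: "'a::ab_group_add set \<Rightarrow> 'a set \<Rightarrow> bool" where
  "finite_symmetric_generators S L \<longleftrightarrow>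
     finite S \<and> (\<forall>x \<in> S. - x \<in> S) \<and> group_closure S = L"

definition cayley_edges :: "'a::ab_group_add set \<Rightarrow> 'a set \<Rightarrow> ('a \<times> 'a) set" where
  "cayley_edges L S = {(x, y). x \<in> L \<and> y \<in> L \<and> y - x \<in> S}"

definition quasi_isometry ::
    "'a set \<Rightarrow> ('a \<Rightarrow> 'a \<Rightarrow> real) \<Rightarrow> 'b set \<Rightarrow> ('b \<Rightarrow> 'b \<Rightarrow> real) \<Rightarrow> ('a \<Rightarrow> 'b) \<Rightarrow> bool" where
  "quasi_isometry M d N e f \<longleftrightarrow>
     f \<in> M \<rightarrow> N \<and>
     (\<exists>A \<ge> 1. \<exists>C \<ge> 0.
        (\<forall>x \<in> M. \<forall>y \<in> M. d x y / A - C \<le> e (f x) (f y) \<and> e (f x) (f y) \<le> A * d x y + C) \<and>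
        (\<forall>z \<in> N. \<exists>x \<in> M. e (f x) z \<le> C))"

end

theory Submission
  imports Defs
begin

text \<open>
  The exchange graph carries an isometric action of the lattice by translations along the belt
  line, so the theorem is an instance of the Milnor--Svarc principle (\<open>milnor_svarc_graph\<close>): a
  group acting by automorphisms on a connected, locally finite graph, with finitely many orbits of
  vertices and with trivial stabiliser of a base vertex, is finitely generated and quasi-isometric
  to the graph through the orbit map, whatever finite generating set is used. Connectedness is
  built into the definition of the exchange graph, and local finiteness holds because a seed has
  three mutations and mutation is an involution. What has to be shown is that there are finitely
  many seeds modulo translation, and that all translations between seeds are parallel to the belt
  line, hence commute with mutation.

  Both come from one invariant. Restrict affine functions to the belt line: the Wronskian of the
  two restrictions is a skew form \<open>\<omega>\<close> on the three-dimensional space of affine functions, whose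
  radical is spanned by the functions vanishing on the belt line. For the initial seed and a suitable
  scaling, \<open>\<omega>(v\<^sub>i, v\<^sub>j) = b\<^sub>i\<^sub>j\<close>; this says that the belt line is the zero line of
  \<open>\<Sum> z\<^sub>i v\<^sub>i\<close> with \<open>z\<close> in the kernel of \<open>B\<close>. If this
  equation holds for every seed, then a seed is determined up to a translation along the belt line by
  the gradients of its vectors together with \<open>B\<close>, because \<open>\<omega>\<close> prescribes the relative positions of
  the points in which the three lines meet the belt. The gradients run through a finite root system
  of dihedral type (angles are multiples of \<open>\<alpha>\<close>) and the entries of \<open>B\<close> are, up to sign, their inner
  products. So finitely many seeds remain (\<open>finite_shapes\<close>, \<open>belt_seed_same_translate\<close>); and a
  translation that preserves the equation preserves the radical of \<open>\<omega>\<close>, hence the belt line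
  (\<open>belt_seed_translate_parallel\<close>).

  Mutation preserves \<open>\<omega>(v\<^sub>i, v\<^sub>j) = b\<^sub>i\<^sub>j\<close> as soon as every vector that is reflected has the
  sign of inner product that turns the reflection into \<open>v\<^sub>i + |b\<^sub>i\<^sub>k| v\<^sub>k\<close>. This sign condition has to
  be carried along, and the right form is that of an exceptional sequence, as for the c-vectors of a
  cluster algebra: the three vectors can be ordered as \<open>f, g, h\<close> so that \<open>\<omega>\<close> and the inner product
  agree on the pairs \<open>(f, g), (f, h), (g, h)\<close>, with \<open>f\<close> negative and \<open>h\<close> positive. Moreover the angle of
  \<open>g\<close>, measured against the belt, is the sum of the angles of \<open>f\<close> and \<open>h\<close> modulo \<open>\<pi>\<close>, with a sign
  that makes the inner products of \<open>g\<close> with \<open>f\<close> and \<open>h\<close> negative (\<open>exceptional\<close>). A mutation acts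
  on such triples as a braid move, and six short computations show that the result is again such a
  triple (\<open>belt_seed_mutation\<close>). Apart from the finiteness of the root system, the only
  arithmetic input is that \<open>2n + 1\<close> is odd, so that no two roots are orthogonal.
\<close>

section \<open>Group actions on graphs\<close>

lemma relpow_add_path:
  "(x, y) \<in> E ^^ a \<Longrightarrow> (y, z) \<in> E ^^ b \<Longrightarrow> (x, z) \<in> E ^^ (a + b)"
  by (auto simp: relpow_add)

lemma relpow_sym:
  assumes "sym E" "(x, y) \<in> E ^^ m" shows "(y, x) \<in> E ^^ m"
  using assms(2)
proof (induction m arbitrary: y)
  case (Suc m)
  then obtain z where "(x, z) \<in> E ^^ m" "(z, y) \<in> E" by auto
  with Suc.IH assms(1) show ?case by (meson relpow_Suc_I2 symD)
qed simp

lemma relpow_equivariant: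
  assumes "\<And>x y. (x, y) \<in> E \<Longrightarrow> (f x, f y) \<in> E'" "(x, y) \<in> E ^^ m"
  shows "(f x, f y) \<in> E' ^^ m"
  using assms(2)
proof (induction m arbitrary: y)
  case (Suc m)
  then show ?case using assms(1) by fastforce
qed simp

lemma graph_dist_least:
  assumes "(x, y) \<in> E ^^ m"
  obtains k where "graph_dist E x y = real k" "k \<le> m" "(x, y) \<in> E ^^ k"
  using assms unfolding graph_dist_def by (metis (mono_tags, lifting) LeastI Least_le)

lemma finite_sphere:
  fixes E :: "('a \<times> 'a) set"
  assumes "\<And>x. finite (E `` {x})" shows "finite ((E ^^ m) `` {x})"
proof (induction m)
  case (Suc m)
  have "(E ^^ Suc m) `` {x} = (\<Union>y \<in> (E ^^ m) `` {x}. E `` {y})" by auto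
  with Suc assms show ?case by simp
qed simp

lemma group_closure_closed:
  assumes "0 \<in> L" "\<And>g h. g \<in> L \<Longrightarrow> h \<in> L \<Longrightarrow> g - h \<in> L" "S \<subseteq> L"
  shows "group_closure S \<subseteq> L"
proof
  fix g assume "g \<in> group_closure S"
  then show "g \<in> L" by induction (use assms in auto)
qed

lemma cayley_translate:
  assumes "\<And>g h. g \<in> L \<Longrightarrow> h \<in> L \<Longrightarrow> g + h \<in> L" "k \<in> L" "(g, h) \<in> cayley_edges L S ^^ m"
  shows "(k + g, k + h) \<in> cayley_edges L S ^^ m"
  by (rule relpow_equivariant[OF _ assms(3)]) (use assms(1,2) in \<open>auto simp: cayley_edges_def\<close>)

lemma cayley_connected:
  assumes "\<And>x. x \<in> S \<Longrightarrow> - x \<in> S" "g \<in> group_closure S"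
  shows "\<exists>m. (0, g) \<in> cayley_edges (group_closure S) S ^^ m"
proof -
  let ?L = "group_closure S" and ?E = "cayley_edges (group_closure S) S"
  have symE: "sym ?E"
    unfolding sym_def cayley_edges_def using assms(1) by (auto, metis minus_diff_eq)
  show ?thesis using assms(2)
  proof induction
    case (base s)
    then show ?case
    proof
      assume "s = 0"
      then have "(0, s) \<in> ?E ^^ 0" by simp
      then show ?thesis by blast
    next
      assume "s \<in> S"
      then have "(0, s) \<in> ?E ^^ 1" by (auto simp: cayley_edges_def group_closure.base)
      then show ?thesis by blast
    qed
  next
    case (diff g h)
    then obtain a b where a: "(0, g) \<in> ?E ^^ a" and b: "(0, h) \<in> ?E ^^ b" by blast
    have "(g - h + 0, g - h + h) \<in> ?E ^^ b"
      by (rule cayley_translate[OF _ _ b]) (use diff.hyps in \<open>auto intro: group_closure_add group_closure.diff\<close>)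
    then have "(g, g - h) \<in> ?E ^^ b" using relpow_sym[OF symE] by simp
    with a show ?case by (meson relpow_add_path)
  qed
qed

text \<open>Every vertex lies within some distance \<open>R\<close> of the orbit of \<open>x0\<close>. Let \<open>N\<close> be the set of group elements
  moving \<open>x0\<close> by at most \<open>2 R + 1\<close>; it is finite since balls are finite and the orbit map is
  injective. Following a path from \<open>x0\<close> to \<open>T g x0\<close> and choosing an orbit point near each of its
  vertices writes \<open>g\<close> as a sum of elements of \<open>N\<close>, one for each edge and one more. So \<open>N\<close>
  generates, and the word length for \<open>N\<close> is bounded by the graph distance; another finite generating
  set changes word lengths by at most a constant factor.\<close>

theorem milnor_svarc_graph:
  fixes L :: "'g::ab_group_add set" and T :: "'g \<Rightarrow> 'v \<Rightarrow> 'v"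
  assumes L0: "0 \<in> L" and Ldiff: "\<And>g h. g \<in> L \<Longrightarrow> h \<in> L \<Longrightarrow> g - h \<in> L"
    and x0: "x0 \<in> V" and EV: "E \<subseteq> V \<times> V" and symE: "sym E"
    and conn: "\<And>x. x \<in> V \<Longrightarrow> (x0, x) \<in> E\<^sup>*"
    and locfin: "\<And>x. finite (E `` {x})"
    and T0: "\<And>x. T 0 x = x" and Tadd: "\<And>g h x. T (g + h) x = T g (T h x)"
    and TE: "\<And>g x y. g \<in> L \<Longrightarrow> (x, y) \<in> E \<Longrightarrow> (T g x, T g y) \<in> E"
    and TV: "\<And>g x. g \<in> L \<Longrightarrow> x \<in> V \<Longrightarrow> T g x \<in> V"
    and free: "\<And>g. g \<in> L \<Longrightarrow> T g x0 = x0 \<Longrightarrow> g = 0"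
    and finK: "finite K" and KV: "K \<subseteq> V"
    and cocompact: "\<And>y. y \<in> V \<Longrightarrow> \<exists>g \<in> L. \<exists>x \<in> K. y = T g x"
  shows "(\<exists>S. finite_symmetric_generators S L) \<and>
    (\<forall>S. finite_symmetric_generators S L \<longrightarrow>
      quasi_isometry L (graph_dist (cayley_edges L S)) V (graph_dist E) (\<lambda>g. T g x0))"
proof -
  have Lminus: "- g \<in> L" if "g \<in> L" for g using Ldiff[OF L0 that] by simp
  have Ladd: "g + h \<in> L" if "g \<in> L" "h \<in> L" for g h
    using Ldiff[OF that(1) Lminus[OF that(2)]] by simp
  have Tpath: "(T g x, T g y) \<in> E ^^ m" if "g \<in> L" "(x, y) \<in> E ^^ m" for g x y m
    using relpow_equivariant[OF TE[OF that(1)] that(2)] .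
  have Tpath_diff: "(x0, T (h - g) x0) \<in> E ^^ m" if "g \<in> L" "(T g x0, T h x0) \<in> E ^^ m" for g h m
    using Tpath[OF Lminus[OF that(1)] that(2)] Tadd[of "-g" g x0] Tadd[of "-g" h x0] T0 by simp
  obtain len where len: "\<And>x. x \<in> V \<Longrightarrow> (x0, x) \<in> E ^^ len x"
    using conn unfolding rtrancl_power by metis
  obtain R where R: "\<And>x. x \<in> K \<Longrightarrow> len x \<le> R"
    using finite_imageI[OF finK, of len] unfolding finite_nat_set_iff_bounded_le by auto
  have near: "\<exists>g \<in> L. \<exists>m \<le> R. (T g x0, y) \<in> E ^^ m" if y: "y \<in> V" for y
  proof -
    obtain g x where gx: "g \<in> L" "x \<in> K" "y = T g x" using cocompact[OF y] by blast
    with Tpath[OF gx(1) len[of x]] KV R[OF gx(2)] show ?thesis by blast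
  qed
  define N where "N = {g \<in> L. \<exists>m \<le> 2 * R + 1. (x0, T g x0) \<in> E ^^ m}"
  have inj: "inj_on (\<lambda>g. T g x0) N"
  proof (rule inj_onI)
    fix g h assume gh: "g \<in> N" "h \<in> N" "T g x0 = T h x0"
    have "T (- h + g) x0 = T (- h + h) x0" unfolding Tadd gh(3) ..
    then have "T (g - h) x0 = x0" using T0 by simp
    moreover have "g - h \<in> L" using gh Ldiff by (auto simp: N_def)
    ultimately show "g = h" using free by force
  qed
  have "(\<lambda>g. T g x0) ` N \<subseteq> (\<Union>m \<in> {..2 * R + 1}. (E ^^ m) `` {x0})"
    by (auto simp: N_def)
  then have "finite ((\<lambda>g. T g x0) ` N)"
    by (rule finite_subset) (use finite_sphere[OF locfin] in auto)
  then have finN: "finite N" using finite_imageD inj by blast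
  have Nsym: "- g \<in> N" if g: "g \<in> N" for g
  proof -
    have "g \<in> L" "\<exists>m \<le> 2 * R + 1. (x0, T g x0) \<in> E ^^ m" using g by (simp_all add: N_def)
    then obtain m where m: "m \<le> 2 * R + 1" "(x0, T g x0) \<in> E ^^ m" "g \<in> L" by blast
    have "(T g x0, T 0 x0) \<in> E ^^ m" using relpow_sym[OF symE m(2)] T0 by simp
    from Tpath_diff[OF m(3) this] m Lminus show ?thesis by (auto simp: N_def)
  qed
  \<comment> \<open>Consecutive orbit points chosen along a path differ by an element of \<open>N\<close>:
    the detour through the path has length at most \<open>R + 1 + R\<close>.\<close>
  have track: "(0, g) \<in> cayley_edges L N ^^ Suc m"
    if "(x0, y) \<in> E ^^ m" "g \<in> L" "(T g x0, y) \<in> E ^^ j" "j \<le> R" for y m g j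
    using that
  proof (induction m arbitrary: y g j)
    case 0
    then have "(x0, T g x0) \<in> E ^^ j" "j \<le> 2 * R + 1" using relpow_sym[OF symE 0(3)] by auto
    then have "g \<in> N" using 0(2) unfolding N_def by blast
    then show ?case using L0 \<open>g \<in> L\<close> by (auto simp: cayley_edges_def)
  next
    case (Suc m)
    then obtain z where z: "(x0, z) \<in> E ^^ m" "(z, y) \<in> E" by auto
    then have "z \<in> V" using EV by auto
    from near[OF this] obtain h i where h: "h \<in> L" "i \<le> R" "(T h x0, z) \<in> E ^^ i" by blast
    have "(T h x0, y) \<in> E ^^ Suc i" using h(3) z(2) by auto
    from relpow_add_path[OF this relpow_sym[OF symE Suc.prems(3)]]
    have "(x0, T (g - h) x0) \<in> E ^^ (Suc i + j)" by (rule Tpath_diff[OF h(1)])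
    moreover have "Suc i + j \<le> 2 * R + 1" using h(2) Suc.prems(4) by simp
    ultimately have "g - h \<in> N" using Ldiff[OF Suc.prems(2) h(1)] unfolding N_def by blast
    then have "(h, g) \<in> cayley_edges L N" using h(1) Suc.prems(2) by (auto simp: cayley_edges_def)
    with Suc.IH[OF z(1) h(1,3,2)] show ?case by auto
  qed
  have track': "(0, g) \<in> cayley_edges L N ^^ Suc m" if "g \<in> L" "(x0, T g x0) \<in> E ^^ m" for g m
    by (rule track[OF that(2,1), of 0]) auto
  have "g \<in> group_closure N" if "(0, g) \<in> cayley_edges L N ^^ m" for g m
    using that
  proof (induction m arbitrary: g)
    case (Suc m)
    then obtain h where h: "(0, h) \<in> cayley_edges L N ^^ m" "g - h \<in> N" by (auto simp: cayley_edges_def)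
    have "h + (g - h) \<in> group_closure N"
      by (rule group_closure_add[OF Suc.IH[OF h(1)] group_closure.base]) (use h(2) in simp)
    then show ?case by simp
  qed simp
  then have "L \<subseteq> group_closure N" using track' len[OF TV[OF _ x0]] by blast
  then have gen: "finite_symmetric_generators N L"
    unfolding finite_symmetric_generators_def
    using finN Nsym group_closure_closed[OF L0 Ldiff, of N] by (auto simp: N_def)
  have "quasi_isometry L (graph_dist (cayley_edges L S)) V (graph_dist E) (\<lambda>g. T g x0)"
    if S: "finite_symmetric_generators S L" for S
  proof -
    let ?C = "cayley_edges L S"
    have finS: "finite S" and LS: "L = group_closure S" and Ssym: "\<And>x. x \<in> S \<Longrightarrow> - x \<in> S"
      using S by (auto simp: finite_symmetric_generators_def)
    obtain wl where wl: "\<And>g. g \<in> L \<Longrightarrow> (0, g) \<in> ?C ^^ wl g"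
      using cayley_connected[of S, OF Ssym] unfolding LS by metis
    obtain P where P: "\<And>g. g \<in> N \<Longrightarrow> wl g \<le> P"
      using finite_imageI[OF finN, of wl] unfolding finite_nat_set_iff_bounded_le by auto
    obtain Q where Q: "\<And>g. g \<in> S \<Longrightarrow> len (T g x0) \<le> Q"
      using finite_imageI[OF finS, of "\<lambda>g. len (T g x0)"] unfolding finite_nat_set_iff_bounded_le by auto
    have CN: "\<exists>k \<le> P * m. (g, h) \<in> ?C ^^ k" if "(g, h) \<in> cayley_edges L N ^^ m" for g h m
      using that
    proof (induction m arbitrary: h)
      case (Suc m)
      then obtain i where i: "(g, i) \<in> cayley_edges L N ^^ m" "i \<in> L" "h \<in> L" "h - i \<in> N"
        by (auto simp: cayley_edges_def)
      obtain k where k: "k \<le> P * m" "(g, i) \<in> ?C ^^ k" using Suc.IH[OF i(1)] by blast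
      have "(i + 0, i + (h - i)) \<in> ?C ^^ wl (h - i)"
        by (rule cayley_translate[OF Ladd i(2) wl]) (use i Ldiff in auto)
      then have "(g, h) \<in> ?C ^^ (k + wl (h - i))" using relpow_add_path k(2) by fastforce
      moreover have "k + wl (h - i) \<le> P * Suc m" using k(1) P[OF i(4)] by simp
      ultimately show ?case by blast
    qed auto
    have EC: "\<exists>k \<le> Q * m. (T g x0, T h x0) \<in> E ^^ k" if "(g, h) \<in> ?C ^^ m" for g h m
      using that
    proof (induction m arbitrary: h)
      case (Suc m)
      then obtain i where i: "(g, i) \<in> ?C ^^ m" "i \<in> L" "h \<in> L" "h - i \<in> S"
        by (auto simp: cayley_edges_def)
      obtain k where k: "k \<le> Q * m" "(T g x0, T i x0) \<in> E ^^ k" using Suc.IH[OF i(1)] by blast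
      have "(T i x0, T i (T (h - i) x0)) \<in> E ^^ len (T (h - i) x0)"
        by (rule Tpath[OF i(2) len[OF TV[OF Ldiff[OF i(3,2)] x0]]])
      then have "(T i x0, T h x0) \<in> E ^^ len (T (h - i) x0)" using Tadd[of i "h - i" x0] by simp
      then have "(T g x0, T h x0) \<in> E ^^ (k + len (T (h - i) x0))" using relpow_add_path k(2) by fastforce
      moreover have "k + len (T (h - i) x0) \<le> Q * Suc m" using k(1) Q[OF i(4)] by simp
      ultimately show ?case by blast
    qed auto
    \<comment> \<open>\<open>P\<close> bounds the \<open>S\<close>-length of elements of \<open>N\<close>, and \<open>Q\<close> the distance by which a
      generator in \<open>S\<close> moves \<open>x0\<close>.\<close>
    define A where "A = real P + real Q + 1"
    define c where "c = real R + 1"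
    have "graph_dist ?C g h / A - c \<le> graph_dist E (T g x0) (T h x0) \<and>
          graph_dist E (T g x0) (T h x0) \<le> A * graph_dist ?C g h + c"
      if g: "g \<in> L" and h: "h \<in> L" for g h
    proof
      have gh: "h - g \<in> L" using g h Ldiff by blast
      have "(g + 0, g + (h - g)) \<in> ?C ^^ wl (h - g)" by (rule cayley_translate[OF Ladd g wl[OF gh]])
      then have "(g, h) \<in> ?C ^^ wl (h - g)" by simp
      then obtain m where m: "graph_dist ?C g h = real m" "(g, h) \<in> ?C ^^ m"
        using graph_dist_least by metis
      obtain k where k: "k \<le> Q * m" "(T g x0, T h x0) \<in> E ^^ k" using EC[OF m(2)] by blast
      obtain l where l: "graph_dist E (T g x0) (T h x0) = real l" "l \<le> k" "(T g x0, T h x0) \<in> E ^^ l"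
        using graph_dist_least[OF k(2)] by metis
      have "real l \<le> real (Q * m)" using l(2) k(1) by linarith
      also have "\<dots> \<le> A * real m" unfolding A_def by (simp add: algebra_simps)
      finally show "graph_dist E (T g x0) (T h x0) \<le> A * graph_dist ?C g h + c"
        unfolding l m c_def by simp
      have "(0, h - g) \<in> cayley_edges L N ^^ Suc l" by (rule track'[OF gh Tpath_diff[OF g l(3)]])
      from CN[OF this] obtain j where j: "j \<le> P * Suc l" "(0, h - g) \<in> ?C ^^ j" by blast
      have "(g + 0, g + (h - g)) \<in> ?C ^^ j" by (rule cayley_translate[OF Ladd g j(2)])
      then have "(g, h) \<in> ?C ^^ j" by simp
      then obtain m' where "graph_dist ?C g h = real m'" "m' \<le> j" using graph_dist_least by metis
      then have "graph_dist ?C g h \<le> real (P * Suc l)" using j(1) by linarith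
      also have "\<dots> \<le> A * (real l + 1)" unfolding A_def by (simp add: algebra_simps)
      finally have "graph_dist ?C g h / A \<le> real l + 1"
        by (subst pos_divide_le_eq) (auto simp: A_def mult.commute)
      then show "graph_dist ?C g h / A - c \<le> graph_dist E (T g x0) (T h x0)"
        unfolding l c_def by simp
    qed
    moreover have "\<exists>g \<in> L. graph_dist E (T g x0) y \<le> c" if y: "y \<in> V" for y
    proof -
      obtain g m where g: "g \<in> L" "m \<le> R" "(T g x0, y) \<in> E ^^ m" using near[OF y] by blast
      obtain k where "graph_dist E (T g x0) y = real k" "k \<le> m" using graph_dist_least[OF g(3)] by metis
      then show ?thesis using g unfolding c_def by (intro bexI[of _ g]) auto
    qed
    moreover have "A \<ge> 1" "c \<ge> 0" unfolding A_def c_def by auto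
    ultimately show ?thesis unfolding quasi_isometry_def using TV x0 by blast
  qed
  with gen show ?thesis by blast
qed

section \<open>Roots relative to the belt line\<close>

definition reflect :: "afun \<Rightarrow> afun \<Rightarrow> afun" where
  "reflect f g = f - form f g *\<^sub>R g"

lemma form_simps:
  "form (- f) g = - form f g" "form f (- g) = - form f g"
  "form (f - f') g = form f g - form f' g" "form f (g - g') = form f g - form f g'"
  "form (c *\<^sub>R f) g = c * form f g" "form f (c *\<^sub>R g) = c * form f g"
  by (auto simp: form_def inner_diff_left inner_diff_right)

lemma form_commute: "form f g = form g f"
  by (simp add: form_def inner_commute)

text \<open>The belt line passes through \<open>F\<close> in the direction of the unit vector \<open>d\<close>, and \<open>e\<close> is a unit vector
  orthogonal to it, on either side. The constant \<open>\<kappa>\<close> scales the Wronskian.\<close>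

locale belt =
  fixes F d e :: "real^2" and \<kappa> \<alpha> :: real and n :: nat
  assumes orthonormal: "d \<bullet> d = 1" "e \<bullet> e = 1" "d \<bullet> e = 0"
    and inner_expand: "x \<bullet> y = (x \<bullet> d) * (y \<bullet> d) + (x \<bullet> e) * (y \<bullet> e)"
    and \<kappa>: "\<kappa> \<noteq> 0" and \<alpha>: "\<alpha> = pi / (2 * real n + 1)"
begin

text \<open>A function with gradient of norm \<open>sqrt 2\<close> is described by the angle of its zero line against the
  belt, in the form of \<open>sine\<close> and \<open>cosine\<close>, and by its value at \<open>F\<close>. The sign of \<open>sine\<close> is chosen so
  that a positive sine means decrease along \<open>d\<close>, that is, a half-plane containing the end of
  the belt; a line parallel to the belt has sine \<open>0\<close>.\<close>

definition sine :: "afun \<Rightarrow> real" where "sine f = - (fst f \<bullet> d) / sqrt 2"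
definition cosine :: "afun \<Rightarrow> real" where "cosine f = (fst f \<bullet> e) / sqrt 2"
definition height :: "afun \<Rightarrow> real" where "height f = aeval f F"

definition positive :: "afun \<Rightarrow> bool" where
  "positive f \<longleftrightarrow> sine f > 0 \<or> sine f = 0 \<and> height f < 0"

text \<open>Up to a constant factor, the Wronskian of the restrictions of \<open>f\<close> and \<open>g\<close> to the belt line.\<close>

definition skew :: "afun \<Rightarrow> afun \<Rightarrow> real" where
  "skew f g = \<kappa> * (sine g * height f - sine f * height g)"

definition root :: "afun \<Rightarrow> bool" where
  "root f \<longleftrightarrow> (\<exists>j::int. cosine f = cos (of_int j * \<alpha>) \<and> sine f = sin (of_int j * \<alpha>))"

lemma coord_simps:
  "sine (f + g) = sine f + sine g" "cosine (f + g) = cosine f + cosine g" "height (f + g) = height f + height g"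
  "sine (- f) = - sine f" "sine (f - g) = sine f - sine g" "sine (c *\<^sub>R f) = c * sine f"
  "cosine (- f) = - cosine f" "cosine (f - g) = cosine f - cosine g" "cosine (c *\<^sub>R f) = c * cosine f"
  "height (- f) = - height f" "height (f - g) = height f - height g" "height (c *\<^sub>R f) = c * height f"
  by (auto simp: sine_def cosine_def height_def aeval_def inner_diff_left inner_add_left
      diff_divide_distrib add_divide_distrib algebra_simps)

lemma form_coords: "form f g = 2 * (cosine f * cosine g + sine f * sine g)"
  unfolding form_def cosine_def sine_def by (subst inner_expand) simp

lemma fst_coords: "fst f = (- sqrt 2 * sine f) *\<^sub>R d + (sqrt 2 * cosine f) *\<^sub>R e" (is "_ = ?v")
proof -
  have "(fst f - ?v) \<bullet> d = 0" "(fst f - ?v) \<bullet> e = 0"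
    using orthonormal inner_commute[of e d]
    by (simp_all add: inner_diff_left inner_add_left sine_def cosine_def)
  then have "(fst f - ?v) \<bullet> (fst f - ?v) = 0" by (subst inner_expand) simp
  then show ?thesis by simp
qed

lemma skew_simps:
  "skew (f + f') g = skew f g + skew f' g" "skew f (g + g') = skew f g + skew f g'"
  "skew (- f) g = - skew f g" "skew f (- g) = - skew f g"
  "skew (f - f') g = skew f g - skew f' g" "skew f (g - g') = skew f g - skew f g'"
  "skew (c *\<^sub>R f) g = c * skew f g" "skew f (c *\<^sub>R g) = c * skew f g"
  by (auto simp: skew_def coord_simps algebra_simps)

lemma skew_self [simp]: "skew f f = 0"
  by (simp add: skew_def)

lemma skew_swap: "skew f g = - skew g f"
  by (simp add: skew_def algebra_simps)

lemma positive_minus: "positive f \<Longrightarrow> \<not> positive (- f)"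
  by (auto simp: positive_def coord_simps)

lemma root_unit: "root f \<Longrightarrow> (cosine f)\<^sup>2 + (sine f)\<^sup>2 = 1"
  by (auto simp: root_def)

lemma root_norm: "root f \<Longrightarrow> form f f = 2"
  using root_unit[of f] by (simp add: form_coords power2_eq_square)

lemma odd_period: "real_of_int (2 * int n + 1) * \<alpha> = pi"
  by (simp add: \<alpha> add_nonneg_eq_0_iff)

lemma root_minus: assumes "root f" shows "root (- f)"
proof -
  obtain j where j: "cosine f = cos (of_int j * \<alpha>)" "sine f = sin (of_int j * \<alpha>)"
    using assms by (auto simp: root_def)
  have "of_int (j + (2 * int n + 1)) * \<alpha> = of_int j * \<alpha> + pi"
    using odd_period by (simp add: algebra_simps)
  then show ?thesis unfolding root_def
    by (intro exI[of _ "j + (2 * int n + 1)"]) (simp add: coord_simps j)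
qed

lemma root_form: assumes "root f" "root g" shows "\<exists>j::int. form f g = 2 * cos (of_int j * \<alpha>)"
proof -
  obtain i j where "cosine f = cos (of_int i * \<alpha>)" "sine f = sin (of_int i * \<alpha>)"
     "cosine g = cos (of_int j * \<alpha>)" "sine g = sin (of_int j * \<alpha>)"
    using assms by (auto simp: root_def)
  then have "form f g = 2 * cos (of_int (i - j) * \<alpha>)"
    by (simp add: form_coords cos_diff left_diff_distrib)
  then show ?thesis by blast
qed

text \<open>Orthogonality would make an integer multiple of \<open>\<alpha>\<close> an odd multiple of \<open>\<pi>/2\<close>, which
  is impossible because \<open>\<alpha>\<close> divides \<open>\<pi>\<close> into an odd number of parts.\<close>

lemma root_not_orthogonal: assumes "root f" "root g" shows "form f g \<noteq> 0"
proof
  assume "form f g = 0"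
  then obtain j :: int where "cos (of_int j * \<alpha>) = 0" using root_form[OF assms] by auto
  then obtain k where k: "of_int j * \<alpha> = of_int k * (pi/2)" "odd k"
    by (auto simp: cos_zero_iff_int)
  have "of_int j * pi = of_int j * (real_of_int (2 * int n + 1) * \<alpha>)" unfolding odd_period ..
  also have "\<dots> = real_of_int (2 * int n + 1) * (of_int k * (pi/2))" using k(1) by (simp add: algebra_simps)
  finally have "pi * of_int (2 * j) = pi * of_int ((2 * int n + 1) * k)" by (simp add: algebra_simps)
  then have "real_of_int (2 * j) = of_int ((2 * int n + 1) * k)" by (simp only: mult_cancel_left pi_neq_zero) simp
  then have "2 * j = (2 * int n + 1) * k" using of_int_eq_iff by blast
  then have "even ((2 * int n + 1) * k)" by (metis dvd_triv_left)
  then show False using k(2) by simp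
qed

lemma root_reflect: assumes "root f" "root g" shows "root (reflect f g)"
proof -
  obtain i j where ij: "cosine f = cos (of_int i * \<alpha>)" "sine f = sin (of_int i * \<alpha>)"
     "cosine g = cos (of_int j * \<alpha>)" "sine g = sin (of_int j * \<alpha>)"
    using assms by (auto simp: root_def)
  let ?x = "of_int i * \<alpha>" and ?y = "of_int j * \<alpha>"
  have arg: "of_int (2 * j - i + (2 * int n + 1)) * \<alpha> = 2 * ?y - ?x + pi"
    using odd_period by (simp add: algebra_simps)
  have "cosine (reflect f g) = cos (2 * ?y - ?x + pi)"
    unfolding reflect_def form_coords coord_simps ij cos_periodic_pi cos_diff sin_double cos_double
    using sin_cos_squared_add[of ?y] by algebra
  moreover have "sine (reflect f g) = sin (2 * ?y - ?x + pi)"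
    unfolding reflect_def form_coords coord_simps ij sin_periodic_pi sin_diff sin_double cos_double
    using sin_cos_squared_add[of ?y] by algebra
  ultimately show ?thesis unfolding root_def using arg by metis
qed

lemma finite_root_angles: "finite {(cosine f, sine f) | f. root f}"
proof -
  let ?N = "2 * (2 * int n + 1)"
  have "{(cosine f, sine f) | f. root f} \<subseteq> (\<lambda>j::int. (cos (of_int j * \<alpha>), sin (of_int j * \<alpha>))) ` {0..<?N}"
  proof clarify
    fix f assume "root f"
    then obtain j :: int where j: "cosine f = cos (of_int j * \<alpha>)" "sine f = sin (of_int j * \<alpha>)"
      by (auto simp: root_def)
    define q r where "q = j div ?N" and "r = j mod ?N"
    have "j = r + q * (2 * (2 * int n + 1))" unfolding q_def r_def by (simp only: mod_div_mult_eq)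
    then have "real_of_int j = of_int r + of_int q * (2 * of_int (2 * int n + 1))" by simp
    then have "of_int j * \<alpha> = (of_int r + of_int q * (2 * of_int (2 * int n + 1))) * \<alpha>" by (rule arg_cong)
    then have "of_int j * \<alpha> = of_int r * \<alpha> + of_int q * (2 * (of_int (2 * int n + 1) * \<alpha>))"
      by (simp only: distrib_right mult.assoc)
    then have arg: "of_int j * \<alpha> = of_int r * \<alpha> + of_int q * (2 * pi)" unfolding odd_period .
    have cs: "cos (x + of_int k * (2 * pi)) = cos x" "sin (x + of_int k * (2 * pi)) = sin x" for x :: real and k :: int
      using cos_int_2pin[of k] sin_int_2pin[of k] by (simp_all add: cos_add sin_add mult.commute)
    show "(cosine f, sine f) \<in> (\<lambda>j::int. (cos (of_int j * \<alpha>), sin (of_int j * \<alpha>))) ` {0..<?N}"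
      unfolding j arg cs by (rule image_eqI[of _ _ r]) (auto simp: r_def)
  qed
  then show ?thesis by (rule finite_subset) simp
qed


section \<open>Exceptional triples and braid moves\<close>

text \<open>
  With the bilinear form \<open>E(f, g) = (form f g + skew f g) / 2\<close>, this is \<open>E(g, f) = 0\<close>: the vanishing
  condition on pairs in an exceptional sequence, with \<open>E\<close> in the role of the Euler form.\<close>

definition ordered :: "afun \<Rightarrow> afun \<Rightarrow> bool" where
  "ordered f g \<longleftrightarrow> skew f g = form f g"

lemma ordered_linear:
  "ordered f g \<Longrightarrow> ordered (- f) g" "ordered f g \<Longrightarrow> ordered f (- g)"
  "ordered f h \<Longrightarrow> ordered g h \<Longrightarrow> ordered (f - c *\<^sub>R g) h"
  "ordered f g \<Longrightarrow> ordered f h \<Longrightarrow> ordered f (g - c *\<^sub>R h)"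
  by (auto simp: ordered_def skew_simps form_simps)

lemma ordered_braid_right: "root g \<Longrightarrow> ordered f g \<Longrightarrow> ordered (- g) (reflect f g)"
  using root_norm[of g] skew_swap[of g f] form_commute[of g f]
  by (simp add: ordered_def reflect_def skew_simps form_simps)

lemma ordered_braid_left: "root f \<Longrightarrow> ordered f g \<Longrightarrow> ordered (reflect g f) (- f)"
  using root_norm[of f] skew_swap[of g f] form_commute[of g f]
  by (simp add: ordered_def reflect_def skew_simps form_simps)

lemma ordered_reflect_right:
  "root h \<Longrightarrow> ordered f g \<Longrightarrow> ordered f h \<Longrightarrow> ordered g h \<Longrightarrow> ordered (reflect f h) (reflect g h)"
  using root_norm[of h] skew_swap[of h g] form_commute[of h g]
  by (simp add: ordered_def reflect_def skew_simps form_simps)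

lemma ordered_reflect_left:
  "root f \<Longrightarrow> ordered f g \<Longrightarrow> ordered f h \<Longrightarrow> ordered g h \<Longrightarrow> ordered (reflect g f) (reflect h f)"
  using root_norm[of f] skew_swap[of g f] form_commute[of g f] form_commute[of h f]
  by (simp add: ordered_def reflect_def skew_simps form_simps)

text \<open>In terms of unit complex numbers, \<open>g = - \<sigma> f h\<close>: the angle of the middle line is the sum of the
  other two modulo \<open>\<pi>\<close>. Geometrically the line through the feet of two altitudes is antiparallel to the third side.
  Here \<open>\<sigma>\<close> is the common sign of the two cosines; exchanging the two sides of the belt reverses it.\<close>

definition balanced :: "afun \<Rightarrow> afun \<Rightarrow> afun \<Rightarrow> bool" where
  "balanced f g h \<longleftrightarrow> (\<exists>\<sigma>. \<sigma>\<^sup>2 = 1 \<and> \<sigma> * cosine f > 0 \<and> \<sigma> * cosine h > 0 \<and>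
     cosine g = - \<sigma> * (cosine f * cosine h - sine f * sine h) \<and>
     sine g = - \<sigma> * (sine f * cosine h + cosine f * sine h))"

text \<open>If \<open>f\<close> and \<open>h\<close> both had sine \<open>0\<close>, then so would \<open>g\<close> and all three lines would be parallel; the
  nondegeneracy condition excludes this.\<close>

definition exceptional :: "afun \<Rightarrow> afun \<Rightarrow> afun \<Rightarrow> bool" where
  "exceptional f g h \<longleftrightarrow>
     root f \<and> root g \<and> root h \<and> ordered f g \<and> ordered f h \<and> ordered g h \<and>
     positive (- f) \<and> positive h \<and> (sine f \<noteq> 0 \<or> sine h \<noteq> 0) \<and> balanced f g h"

text \<open>Since \<open>f\<close> and \<open>h\<close> are unit complex numbers, \<open>g = - \<sigma> f h\<close> makes an angle with \<open>f\<close> whose cosine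
  is that of \<open>h\<close> up to sign, and conversely.\<close>

lemma balanced_forms:
  assumes "\<sigma>\<^sup>2 = 1" "root f" "root h"
     "cosine g = - \<sigma> * (cosine f * cosine h - sine f * sine h)"
     "sine g = - \<sigma> * (sine f * cosine h + cosine f * sine h)"
  shows "form f g = - 2 * \<sigma> * cosine h" "form g h = - 2 * \<sigma> * cosine f"
  unfolding form_coords assms(4,5) using root_unit[OF assms(2)] root_unit[OF assms(3)] by algebra+

lemma exceptional_forms:
  assumes "exceptional f g h" shows "form f g < 0" "form g h < 0" "form f h \<noteq> 0"
proof -
  obtain \<sigma> where "\<sigma>\<^sup>2 = 1" "\<sigma> * cosine f > 0" "\<sigma> * cosine h > 0"
     "cosine g = - \<sigma> * (cosine f * cosine h - sine f * sine h)"
     "sine g = - \<sigma> * (sine f * cosine h + cosine f * sine h)" and r: "root f" "root h"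
    using assms unfolding exceptional_def balanced_def by blast
  with balanced_forms[of \<sigma> f h g] show "form f g < 0" "form g h < 0" by auto
  show "form f h \<noteq> 0" by (rule root_not_orthogonal[OF r])
qed

text \<open>Both reflected sines equal, up to sign, \<open>\<sigma>\<close> times the sine of the difference of the angles of \<open>h\<close> and
  \<open>f\<close>, which is positive because \<open>\<sigma> cos\<close> is positive for both and the sines have opposite signs. This
  settles the sign of the reflected middle vector, which becomes the outer member at the end where the
  mutation took place.\<close>

lemma exceptional_sine_reflect:
  assumes "exceptional f g h"
  shows "sine (reflect g h) > 0" "sine (reflect g f) < 0"
proof -
  obtain \<sigma> where \<sigma>: "\<sigma>\<^sup>2 = 1" "\<sigma> * cosine f > 0" "\<sigma> * cosine h > 0"
     and g: "cosine g = - \<sigma> * (cosine f * cosine h - sine f * sine h)"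
     "sine g = - \<sigma> * (sine f * cosine h + cosine f * sine h)" and r: "root f" "root h"
    using assms unfolding exceptional_def balanced_def by blast
  have sf: "sine f \<le> 0" and sh: "sine h \<ge> 0" and ne: "sine f \<noteq> 0 \<or> sine h \<noteq> 0"
    using assms by (auto simp: exceptional_def positive_def coord_simps)
  have pos: "\<sigma> * cosine f * sine h - \<sigma> * cosine h * sine f > 0"
  proof -
    have "\<sigma> * cosine f * sine h \<ge> 0" "\<sigma> * cosine h * (- sine f) \<ge> 0"
      using \<sigma>(2,3) sf sh mult_nonneg_nonneg[of "\<sigma> * cosine h" "- sine f"] by auto
    moreover have "\<sigma> * cosine f * sine h > 0 \<or> \<sigma> * cosine h * (- sine f) > 0"
      using ne sf sh \<sigma>(2,3) by (metis less_le mult_pos_pos neg_0_less_iff_less)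
    ultimately show ?thesis by auto
  qed
  have "sine (reflect g h) = \<sigma> * cosine f * sine h - \<sigma> * cosine h * sine f"
    "sine (reflect g f) = - (\<sigma> * cosine f * sine h - \<sigma> * cosine h * sine f)"
    unfolding reflect_def coord_simps form_commute[of g f] balanced_forms[OF \<sigma>(1) r g] g(2)
    by (simp_all add: algebra_simps)
  with pos show "sine (reflect g h) > 0" "sine (reflect g f) < 0" by auto
qed


lemma exceptional_balanced:
  assumes "exceptional f g h"
  obtains \<sigma> where "\<sigma>\<^sup>2 = 1" "\<sigma> * cosine f > 0" "\<sigma> * cosine h > 0"
    "cosine g = - \<sigma> * (cosine f * cosine h - sine f * sine h)"
    "sine g = - \<sigma> * (sine f * cosine h + cosine f * sine h)"
    "form f g = - 2 * \<sigma> * cosine h" "form g h = - 2 * \<sigma> * cosine f"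
    "(cosine f)\<^sup>2 + (sine f)\<^sup>2 = 1" "(cosine h)\<^sup>2 + (sine h)\<^sup>2 = 1"
proof -
  obtain \<sigma> where \<sigma>: "\<sigma>\<^sup>2 = 1" "\<sigma> * cosine f > 0" "\<sigma> * cosine h > 0"
     and g: "cosine g = - \<sigma> * (cosine f * cosine h - sine f * sine h)"
     "sine g = - \<sigma> * (sine f * cosine h + cosine f * sine h)" and r: "root f" "root h"
    using assms unfolding exceptional_def balanced_def by blast
  show thesis using that[OF \<sigma> g balanced_forms[OF \<sigma>(1) r g] root_unit[OF r(1)] root_unit[OF r(2)]] .
qed

text \<open>The next six lemmas treat a mutation at the last, first or middle member. At an outer member the
  neighbour \<open>g\<close> is always reflected, since its inner product is negative; the far member is reflected
  exactly if \<open>form f h\<close> is negative, and this decides where the mutated vector enters the new order.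
  The new cosine at the end is \<open>form f h / 2\<close> up to the sign \<open>\<sigma>\<close>, so the sign of \<open>form f h\<close> also
  decides whether \<open>\<sigma>\<close> changes.\<close>

lemma exceptional_last_both:
  assumes "exceptional f g h" "form f h < 0"
  shows "exceptional (- h) (reflect f h) (reflect g h)"
proof -
  have e: "root f" "root g" "root h" "ordered f g" "ordered f h" "ordered g h" "positive h"
    using assms(1) by (auto simp: exceptional_def)
  have s: "sine (reflect g h) > 0" by (rule exceptional_sine_reflect[OF assms(1)])
  obtain \<sigma> where \<sigma>: "\<sigma>\<^sup>2 = 1" "\<sigma> * cosine f > 0" "\<sigma> * cosine h > 0"
    and g: "cosine g = - \<sigma> * (cosine f * cosine h - sine f * sine h)"
    "sine g = - \<sigma> * (sine f * cosine h + cosine f * sine h)"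
    and fm: "form f g = - 2 * \<sigma> * cosine h" "form g h = - 2 * \<sigma> * cosine f"
    and u: "(cosine f)\<^sup>2 + (sine f)\<^sup>2 = 1" "(cosine h)\<^sup>2 + (sine h)\<^sup>2 = 1"
    by (rule exceptional_balanced[OF assms(1)])
  have "balanced (- h) (reflect f h) (reflect g h)"
    unfolding balanced_def
  proof (intro exI[of _ "- \<sigma>"] conjI)
    show "(- \<sigma>)\<^sup>2 = 1" "- \<sigma> * cosine (- h) > 0" using \<sigma> by (auto simp: coord_simps)
    have "- \<sigma> * cosine (reflect g h) = - form f h / 2"
      unfolding reflect_def coord_simps fm g form_coords[of f h] using \<sigma>(1) by algebra
    then show "- \<sigma> * cosine (reflect g h) > 0" using assms(2) by simp
  qed (unfold reflect_def coord_simps fm g form_coords[of f h], (use \<sigma>(1) u in algebra)+)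
  then show ?thesis unfolding exceptional_def
    using e s root_minus root_reflect ordered_braid_right ordered_reflect_right
    by (auto simp: positive_def)
qed

lemma exceptional_last_one:
  assumes "exceptional f g h" "form f h > 0"
  shows "exceptional f (- h) (reflect g h)"
proof -
  have e: "root f" "root g" "root h" "ordered f g" "ordered f h" "ordered g h" "positive (- f)"
    using assms(1) by (auto simp: exceptional_def)
  have s: "sine (reflect g h) > 0" by (rule exceptional_sine_reflect[OF assms(1)])
  obtain \<sigma> where \<sigma>: "\<sigma>\<^sup>2 = 1" "\<sigma> * cosine f > 0" "\<sigma> * cosine h > 0"
    and g: "cosine g = - \<sigma> * (cosine f * cosine h - sine f * sine h)"
    "sine g = - \<sigma> * (sine f * cosine h + cosine f * sine h)"
    and fm: "form f g = - 2 * \<sigma> * cosine h" "form g h = - 2 * \<sigma> * cosine f"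
    and u: "(cosine f)\<^sup>2 + (sine f)\<^sup>2 = 1" "(cosine h)\<^sup>2 + (sine h)\<^sup>2 = 1"
    by (rule exceptional_balanced[OF assms(1)])
  have "balanced f (- h) (reflect g h)"
    unfolding balanced_def
  proof (intro exI[of _ "\<sigma>"] conjI)
    show "\<sigma>\<^sup>2 = 1" "\<sigma> * cosine f > 0" using \<sigma> by auto
    have "\<sigma> * cosine (reflect g h) = form f h / 2"
      unfolding reflect_def coord_simps fm g form_coords[of f h] using \<sigma>(1) by algebra
    then show "\<sigma> * cosine (reflect g h) > 0" using assms(2) by simp
  qed (unfold reflect_def coord_simps fm g form_coords[of f h], (use \<sigma>(1) u in algebra)+)
  moreover have "ordered f (reflect g h)" unfolding reflect_def by (rule ordered_linear(4)) (use e in auto)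
  ultimately show ?thesis unfolding exceptional_def
    using e s root_minus root_reflect ordered_braid_right ordered_linear(2)
    by (auto simp: positive_def)
qed

lemma exceptional_first_both:
  assumes "exceptional f g h" "form f h < 0"
  shows "exceptional (reflect g f) (reflect h f) (- f)"
proof -
  have e: "root f" "root g" "root h" "ordered f g" "ordered f h" "ordered g h" "positive (- f)"
    using assms(1) by (auto simp: exceptional_def)
  have s: "sine (reflect g f) < 0" by (rule exceptional_sine_reflect[OF assms(1)])
  obtain \<sigma> where \<sigma>: "\<sigma>\<^sup>2 = 1" "\<sigma> * cosine f > 0" "\<sigma> * cosine h > 0"
    and g: "cosine g = - \<sigma> * (cosine f * cosine h - sine f * sine h)"
    "sine g = - \<sigma> * (sine f * cosine h + cosine f * sine h)"
    and fm: "form f g = - 2 * \<sigma> * cosine h" "form g h = - 2 * \<sigma> * cosine f"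
    and u: "(cosine f)\<^sup>2 + (sine f)\<^sup>2 = 1" "(cosine h)\<^sup>2 + (sine h)\<^sup>2 = 1"
    by (rule exceptional_balanced[OF assms(1)])
  have "balanced (reflect g f) (reflect h f) (- f)"
    unfolding balanced_def
  proof (intro exI[of _ "- \<sigma>"] conjI)
    show "(- \<sigma>)\<^sup>2 = 1" "- \<sigma> * cosine (- f) > 0" using \<sigma> by (auto simp: coord_simps)
    have "- \<sigma> * cosine (reflect g f) = - form f h / 2"
      unfolding reflect_def form_commute[of g f] coord_simps fm g form_coords[of f h] using \<sigma>(1) by algebra
    then show "- \<sigma> * cosine (reflect g f) > 0" using assms(2) by simp
  qed (unfold reflect_def form_commute[of g f] coord_simps fm g form_coords[of h f], (use \<sigma>(1) u in algebra)+)
  then show ?thesis unfolding exceptional_def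
    using e s root_minus root_reflect ordered_braid_left ordered_reflect_left
    by (auto simp: positive_def coord_simps)
qed

lemma exceptional_first_one:
  assumes "exceptional f g h" "form f h > 0"
  shows "exceptional (reflect g f) (- f) h"
proof -
  have e: "root f" "root g" "root h" "ordered f g" "ordered f h" "ordered g h" "positive h"
    using assms(1) by (auto simp: exceptional_def)
  have s: "sine (reflect g f) < 0" by (rule exceptional_sine_reflect[OF assms(1)])
  obtain \<sigma> where \<sigma>: "\<sigma>\<^sup>2 = 1" "\<sigma> * cosine f > 0" "\<sigma> * cosine h > 0"
    and g: "cosine g = - \<sigma> * (cosine f * cosine h - sine f * sine h)"
    "sine g = - \<sigma> * (sine f * cosine h + cosine f * sine h)"
    and fm: "form f g = - 2 * \<sigma> * cosine h" "form g h = - 2 * \<sigma> * cosine f"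
    and u: "(cosine f)\<^sup>2 + (sine f)\<^sup>2 = 1" "(cosine h)\<^sup>2 + (sine h)\<^sup>2 = 1"
    by (rule exceptional_balanced[OF assms(1)])
  have "balanced (reflect g f) (- f) h"
    unfolding balanced_def
  proof (intro exI[of _ "\<sigma>"] conjI)
    show "\<sigma>\<^sup>2 = 1" "\<sigma> * cosine h > 0" using \<sigma> by auto
    have "\<sigma> * cosine (reflect g f) = form f h / 2"
      unfolding reflect_def form_commute[of g f] coord_simps fm g form_coords[of f h] using \<sigma>(1) by algebra
    then show "\<sigma> * cosine (reflect g f) > 0" using assms(2) by simp
  qed (unfold reflect_def form_commute[of g f] coord_simps fm g form_coords[of h f], (use \<sigma>(1) u in algebra)+)
  moreover have "ordered (reflect g f) h" unfolding reflect_def by (rule ordered_linear(3)) (use e in auto)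
  ultimately show ?thesis unfolding exceptional_def
    using e s root_minus root_reflect ordered_braid_left ordered_linear(1)
    by (auto simp: positive_def coord_simps)
qed

lemma exceptional_cosine_middle:
  assumes "exceptional f g h"
    and "\<sigma> * cosine f > 0" "\<sigma> * cosine h > 0" "\<sigma>\<^sup>2 = 1"
    and "cosine g = - \<sigma> * (cosine f * cosine h - sine f * sine h)"
  shows "\<sigma> * cosine g < 0"
proof -
  have "sine f \<le> 0" "sine h \<ge> 0" using assms(1) by (auto simp: exceptional_def positive_def coord_simps)
  then have "sine f * sine h \<le> 0" by (rule mult_nonpos_nonneg)
  moreover have "(\<sigma> * cosine f) * (\<sigma> * cosine h) > 0" using assms by simp
  moreover have "\<sigma> * cosine g = - ((\<sigma> * cosine f) * (\<sigma> * cosine h)) + sine f * sine h"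
    unfolding assms(5) using assms(4) by algebra
  ultimately show ?thesis by linarith
qed

text \<open>The middle member may have either sign. Its mutation is a single braid move with the outer member of the
  opposite sign, and the negated middle vector becomes the new outer member on that side.\<close>

lemma exceptional_middle_neg:
  assumes "exceptional f g h" "positive (- g)"
  shows "exceptional f (reflect h g) (- g)"
proof -
  have e: "root f" "root g" "root h" "ordered f g" "ordered f h" "ordered g h" "positive (- f)"
    "sine f \<le> 0" "sine h \<ge> 0"  "sine f \<noteq> 0 \<or> sine h \<noteq> 0"
    using assms(1) by (auto simp: exceptional_def positive_def coord_simps)
  obtain \<sigma> where \<sigma>: "\<sigma>\<^sup>2 = 1" "\<sigma> * cosine f > 0" "\<sigma> * cosine h > 0"
    and g: "cosine g = - \<sigma> * (cosine f * cosine h - sine f * sine h)"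
    "sine g = - \<sigma> * (sine f * cosine h + cosine f * sine h)"
    and fm: "form f g = - 2 * \<sigma> * cosine h" "form g h = - 2 * \<sigma> * cosine f"
    and u: "(cosine f)\<^sup>2 + (sine f)\<^sup>2 = 1" "(cosine h)\<^sup>2 + (sine h)\<^sup>2 = 1"
    by (rule exceptional_balanced[OF assms(1)])
  have "balanced f (reflect h g) (- g)"
    unfolding balanced_def
  proof (intro exI[of _ "\<sigma>"] conjI)
    show "\<sigma>\<^sup>2 = 1" "\<sigma> * cosine f > 0" using \<sigma> by auto
    show "\<sigma> * cosine (- g) > 0"
      using exceptional_cosine_middle[OF assms(1) \<sigma>(2,3,1) g(1)] by (simp add: coord_simps)
  qed (unfold reflect_def form_commute[of h g] coord_simps fm g, (use \<sigma>(1) u in algebra)+)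
  moreover have "ordered f (reflect h g)" unfolding reflect_def by (rule ordered_linear(4)) (use e in auto)
  moreover have "sine f \<noteq> 0 \<or> sine (- g) \<noteq> 0"
    using \<sigma> e(10) by (auto simp: coord_simps g)
  ultimately show ?thesis unfolding exceptional_def
    using e assms(2) root_minus root_reflect ordered_braid_left ordered_linear(2) by auto
qed

lemma exceptional_middle_pos:
  assumes "exceptional f g h" "positive g"
  shows "exceptional (- g) (reflect f g) h"
proof -
  have e: "root f" "root g" "root h" "ordered f g" "ordered f h" "ordered g h" "positive h"
    "sine f \<le> 0" "sine h \<ge> 0"  "sine f \<noteq> 0 \<or> sine h \<noteq> 0"
    using assms(1) by (auto simp: exceptional_def positive_def coord_simps)
  obtain \<sigma> where \<sigma>: "\<sigma>\<^sup>2 = 1" "\<sigma> * cosine f > 0" "\<sigma> * cosine h > 0"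
    and g: "cosine g = - \<sigma> * (cosine f * cosine h - sine f * sine h)"
    "sine g = - \<sigma> * (sine f * cosine h + cosine f * sine h)"
    and fm: "form f g = - 2 * \<sigma> * cosine h" "form g h = - 2 * \<sigma> * cosine f"
    and u: "(cosine f)\<^sup>2 + (sine f)\<^sup>2 = 1" "(cosine h)\<^sup>2 + (sine h)\<^sup>2 = 1"
    by (rule exceptional_balanced[OF assms(1)])
  have "balanced (- g) (reflect f g) h"
    unfolding balanced_def
  proof (intro exI[of _ "\<sigma>"] conjI)
    show "\<sigma>\<^sup>2 = 1" "\<sigma> * cosine h > 0" using \<sigma> by auto
    show "\<sigma> * cosine (- g) > 0"
      using exceptional_cosine_middle[OF assms(1) \<sigma>(2,3,1) g(1)] by (simp add: coord_simps)
  qed (unfold reflect_def coord_simps fm g, (use \<sigma>(1) u in algebra)+)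
  moreover have "ordered (reflect f g) h" unfolding reflect_def by (rule ordered_linear(3)) (use e in auto)
  moreover have "sine (- g) \<noteq> 0 \<or> sine h \<noteq> 0"
    using \<sigma> e(10) by (auto simp: coord_simps g)
  ultimately show ?thesis unfolding exceptional_def
    using e assms(2) root_minus root_reflect ordered_braid_right ordered_linear(1) by (auto simp: positive_def)
qed

end

section \<open>Relabelling, translating and mutating seeds\<close>

lemma relabel_id: "relabel id s = s"
  by (simp add: relabel_def vec_eq_iff prod_eq_iff)

lemma seed_of_self: "s \<in> seed_of s"
  unfolding seed_of_def using relabel_id[of s] by (metis (mono_tags, lifting) bij_id mem_Collect_eq)

lemma seed_of_eqD:
  assumes "seed_of s = seed_of t" obtains \<sigma> where "bij \<sigma>" "s = relabel \<sigma> t"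
  using seed_of_self[of s] assms unfolding seed_of_def by auto

lemma finite_seed_of: "finite (seed_of s)"
proof -
  have "seed_of s \<subseteq> range (\<lambda>\<sigma>. relabel \<sigma> s)" by (auto simp: seed_of_def)
  then show ?thesis by (rule finite_subset) simp
qed

lemma translate_seed_of: "translate_seed w (seed_of s) = seed_of (translate_labelled w s)"
proof -
  have "translate_labelled w (relabel \<sigma> s) = relabel \<sigma> (translate_labelled w s)" for \<sigma>
    by (simp add: translate_labelled_def relabel_def vec_eq_iff)
  then show ?thesis unfolding translate_seed_def seed_of_def setcompr_eq_image image_image by simp
qed

lemma translate_labelled_add:
  "translate_labelled (w + w') s = translate_labelled w (translate_labelled w' s)"
  by (simp add: translate_labelled_def translate_afun_def vec_eq_iff inner_add_right)

lemma translate_labelled_0: "translate_labelled 0 s = s"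
  by (simp add: translate_labelled_def translate_afun_def vec_eq_iff prod_eq_iff)

lemma translate_seed_add: "translate_seed (w + w') C = translate_seed w (translate_seed w' C)"
  by (simp add: translate_seed_def image_image translate_labelled_add)

lemma translate_seed_0: "translate_seed 0 C = C"
  by (simp add: translate_seed_def translate_labelled_0)

lemma reflect_uminus_twice:
  assumes "form g g = 2" shows "reflect (reflect f g) (- g) = f"
proof -
  have "form (reflect f g) (- g) = form f g" using assms by (simp add: reflect_def form_simps)
  then show ?thesis unfolding reflect_def[of _ "- g"] by (simp add: reflect_def)
qed

lemma mutate_matrix_involution: "mutate_matrix k (mutate_matrix k B) = B"
  by (simp add: mutate_matrix_def vec_eq_iff add_divide_distrib diff_divide_distrib)

lemma mutate_vectors_reflect:
  "mutate_vectors pos k v B $ i = (if i = k then - (v $ k)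
     else if pos (v $ k) \<and> B $ i $ k < 0 \<or> pos (- (v $ k)) \<and> B $ i $ k > 0
       then reflect (v $ i) (v $ k) else v $ i)"
  by (simp add: mutate_vectors_def reflect_def)

text \<open>The vector at \<open>k\<close> and the \<open>k\<close>-th column of \<open>B\<close> both change sign, so the same vectors are reflected
  when the mutation is repeated.\<close>

lemma mutation_sym:
  assumes "mutation pos k s t" and norm: "form (fst s $ k) (fst s $ k) = 2"
  shows "mutation pos k t s"
proof -
  obtain v B where s: "s = (v, B)" by fastforce
  have t: "t = (mutate_vectors pos k v B, mutate_matrix k B)" and p: "pos (v $ k) \<or> pos (- (v $ k))"
    using assms(1) by (auto simp: mutation_def s)
  have "mutate_vectors pos k (mutate_vectors pos k v B) (mutate_matrix k B) $ i = v $ i" for i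
  proof (cases "i = k")
    case False
    have [simp]: "mutate_matrix k B $ i $ k = - (B $ i $ k)" by (simp add: mutate_matrix_def)
    show ?thesis using False norm reflect_uminus_twice[of "v $ k" "v $ i"]
      by (auto simp: mutate_vectors_reflect s)
  qed (simp add: mutate_vectors_reflect)
  then have "mutate_vectors pos k (mutate_vectors pos k v B) (mutate_matrix k B) = v"
    by (simp add: vec_eq_iff)
  then show ?thesis using p by (auto simp: mutation_def s t mutate_matrix_involution mutate_vectors_reflect)
qed

lemma mutation_translate:
  assumes "mutation pos k s t" and pos: "\<And>f. pos (translate_afun w f) \<longleftrightarrow> pos f"
  shows "mutation pos k (translate_labelled w s) (translate_labelled w t)"
proof -
  have lin: "translate_afun w (- f) = - translate_afun w f"
    "translate_afun w (reflect f g) = reflect (translate_afun w f) (translate_afun w g)" for f g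
    by (auto simp: translate_afun_def reflect_def form_def prod_eq_iff inner_diff_left algebra_simps)
  have "mutate_vectors pos k (\<chi> i. translate_afun w (v $ i)) B $ i = translate_afun w (mutate_vectors pos k v B $ i)"
    for v B i
    using pos[of "- (v $ k)"] by (simp add: mutate_vectors_reflect lin pos)
  then have "mutate_vectors pos k (\<chi> i. translate_afun w (v $ i)) B = (\<chi> i. translate_afun w (mutate_vectors pos k v B $ i))"
    for v B by (simp add: vec_eq_iff)
  then show ?thesis using assms(1) pos[of "- (fst s $ k)"]
    by (auto simp: mutation_def translate_labelled_def lin pos)
qed

lemma exhaust_3_distinct:
  fixes i j k :: 3
  assumes "i \<noteq> j" "j \<noteq> k" "i \<noteq> k" shows "l = i \<or> l = j \<or> l = k"
  using assms exhaust_3[of i] exhaust_3[of j] exhaust_3[of k] exhaust_3[of l] by auto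

lemma finite_vec:
  assumes "finite A" shows "finite {v :: 'a ^ 'n. \<forall>i. v $ i \<in> A}"
proof -
  have "{v :: 'a ^ 'n. \<forall>i. v $ i \<in> A} \<subseteq> vec_lambda ` (UNIV \<rightarrow>\<^sub>E A)"
    by (rule subsetI, rule image_eqI[of _ _ "($) _"]) (auto simp: vec_lambda_eta PiE_def)
  then show ?thesis by (rule finite_subset) (simp add: assms finite_PiE)
qed

section \<open>Seeds compatible with the belt line\<close>

text \<open>The two ways of writing matrix mutation, by truncation with a sign \<open>\<epsilon>\<close> and by absolute values, agree for
  either sign; here \<open>x = b\<^sub>l\<^sub>k\<close> and \<open>y = b\<^sub>m\<^sub>k = - b\<^sub>k\<^sub>m\<close>.\<close>

lemma mutation_arith:
  fixes x y \<epsilon> :: real assumes "\<epsilon> = 1 \<or> \<epsilon> = -1"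
  shows "max (\<epsilon> * x) 0 * (- y) + max (\<epsilon> * y) 0 * x = (x * \<bar>- y\<bar> + \<bar>x\<bar> * (- y)) / 2"
  using assms by (elim disjE; cases "x < 0"; cases "y < 0"; simp add: max_def abs_if)

context belt
begin

definition compatible :: "labelled_seed \<Rightarrow> bool" where
  "compatible s \<longleftrightarrow> (\<forall>l m. skew (fst s $ l) (fst s $ m) = snd s $ l $ m)"

definition belt_seed :: "labelled_seed \<Rightarrow> bool" where
  "belt_seed s \<longleftrightarrow> compatible s \<and> (\<exists>i j k. i \<noteq> j \<and> j \<noteq> k \<and> i \<noteq> k \<and>
     exceptional (fst s $ i) (fst s $ j) (fst s $ k))"

text \<open>If the vectors change by \<open>v\<^sub>i \<mapsto> v\<^sub>i + max (\<epsilon> b\<^sub>i\<^sub>k) 0 v\<^sub>k\<close>, then the Gram matrix of the skew form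
  undergoes matrix mutation.\<close>

lemma mutate_compatible:
  assumes s: "compatible s" and k: "fst t $ k = - (fst s $ k)" and B: "snd t = mutate_matrix k (snd s)"
    and \<epsilon>: "\<epsilon> = 1 \<or> \<epsilon> = -1"
    and i: "\<And>i. i \<noteq> k \<Longrightarrow> fst t $ i = fst s $ i + max (\<epsilon> * snd s $ i $ k) 0 *\<^sub>R (fst s $ k)"
  shows "compatible t"
  unfolding compatible_def
proof (intro allI)
  fix l m
  have sk: "skew (fst s $ l) (fst s $ m) = snd s $ l $ m" for l m using s by (simp add: compatible_def)
  have anti: "snd s $ k $ l = - (snd s $ l $ k)" for l
    using skew_swap[of "fst s $ k" "fst s $ l"] by (simp add: sk)
  have diag: "snd s $ k $ k = 0" using sk[of k k] by simp
  show "skew (fst t $ l) (fst t $ m) = snd t $ l $ m"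
  proof (cases "l = k \<or> m = k")
    case True
    then show ?thesis
      by (cases "l = k"; cases "m = k") (auto simp: k i skew_simps sk B mutate_matrix_def diag simp flip: anti)
  next
    case False
    then have lm: "l \<noteq> k" "m \<noteq> k" by auto
    have "skew (fst t $ l) (fst t $ m) = snd s $ l $ m
        + max (\<epsilon> * snd s $ l $ k) 0 * snd s $ k $ m + max (\<epsilon> * snd s $ m $ k) 0 * snd s $ l $ k"
      unfolding i[OF lm(1)] i[OF lm(2)] skew_simps sk skew_self by (simp add: algebra_simps diag)
    also have "\<dots> = snd t $ l $ m"
      using lm mutation_arith[OF \<epsilon>, of "snd s $ l $ k" "snd s $ m $ k"]
      by (simp add: B mutate_matrix_def anti)
    finally show ?thesis .
  qed
qed

text \<open>The sign condition says that each reflected vector satisfies \<open>form (v\<^sub>i) (v\<^sub>k) = - |b\<^sub>i\<^sub>k|\<close>, so that its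
  reflection has the shape required in \<open>mutate_compatible\<close>.\<close>

lemma mutation_compatible:
  assumes s: "compatible s" and "mutation positive l s t"
    and sgn: "\<And>m. m \<noteq> l \<Longrightarrow> positive (fst s $ l) \<Longrightarrow> snd s $ m $ l < 0 \<Longrightarrow>
       form (fst s $ m) (fst s $ l) = snd s $ m $ l"
     "\<And>m. m \<noteq> l \<Longrightarrow> positive (- (fst s $ l)) \<Longrightarrow> snd s $ m $ l > 0 \<Longrightarrow>
       form (fst s $ m) (fst s $ l) = - (snd s $ m $ l)"
  shows "compatible t"
proof -
  have t: "t = (mutate_vectors positive l (fst s) (snd s), mutate_matrix l (snd s))"
    and p: "positive (fst s $ l) \<or> positive (- (fst s $ l))"
    using assms(2) by (auto simp: mutation_def)
  from p show ?thesis
  proof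
    assume "positive (fst s $ l)"
    then show ?thesis using positive_minus[of "fst s $ l"] sgn(1)
      by (intro mutate_compatible[OF s, of t l "-1"])
        (auto simp: t mutate_vectors_reflect reflect_def max_def)
  next
    assume "positive (- (fst s $ l))"
    then show ?thesis using positive_minus[of "fst s $ l"] sgn(2)
      by (intro mutate_compatible[OF s, of t l "1"])
        (auto simp: t mutate_vectors_reflect reflect_def max_def)
  qed
qed

text \<open>The order of an exceptional triple expresses all entries of \<open>B\<close> by inner products, whose signs are
  known except for the pair of outer members. This yields the sign condition of
  \<open>mutation_compatible\<close> and selects the braid move that describes the mutation.\<close>

lemma belt_seed_mutation:
  assumes "belt_seed s" "mutation positive l s t"
  shows "belt_seed t"
proof -
  obtain v B where s: "s = (v, B)" by fastforce
  obtain i j k where ne: "i \<noteq> j" "j \<noteq> k" "i \<noteq> k" and ex: "exceptional (v $ i) (v $ j) (v $ k)"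
    and comp: "compatible s"
    using assms(1) unfolding belt_seed_def s by auto
  have t: "t = (mutate_vectors positive l v B, mutate_matrix l B)"
    and p: "positive (v $ l) \<or> positive (- (v $ l))"
    using assms(2) by (auto simp: mutation_def s)
  have sk: "B $ a $ b = skew (v $ a) (v $ b)" for a b using comp by (simp add: compatible_def s)
  have ord: "skew (v $ i) (v $ j) = form (v $ i) (v $ j)" "skew (v $ i) (v $ k) = form (v $ i) (v $ k)"
    "skew (v $ j) (v $ k) = form (v $ j) (v $ k)"
    and pi: "positive (- (v $ i))" and pk: "positive (v $ k)"
    using ex by (auto simp: exceptional_def ordered_def)
  note fm = exceptional_forms[OF ex]
  have B: "B $ i $ j = form (v $ i) (v $ j)" "B $ i $ k = form (v $ i) (v $ k)" "B $ j $ k = form (v $ j) (v $ k)"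
    "B $ j $ i = - form (v $ i) (v $ j)" "B $ k $ i = - form (v $ i) (v $ k)" "B $ k $ j = - form (v $ j) (v $ k)"
    using ord skew_swap[of "v $ j" "v $ i"] skew_swap[of "v $ k" "v $ i"] skew_swap[of "v $ k" "v $ j"]
    by (auto simp: sk)
  have fc: "form (v $ j) (v $ i) = form (v $ i) (v $ j)" "form (v $ k) (v $ i) = form (v $ i) (v $ k)"
     "form (v $ k) (v $ j) = form (v $ j) (v $ k)" by (rule form_commute)+
  have npi: "\<not> positive (v $ i)" and npk: "\<not> positive (- (v $ k))"
    using pi pk positive_minus[of "v $ i"] positive_minus[of "v $ k"] by auto
  have cases3: "m = i \<or> m = j \<or> m = k" for m by (rule exhaust_3_distinct[OF ne])
  have "compatible t"
  proof (rule mutation_compatible[OF comp assms(2)])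
    fix m assume "m \<noteq> l" "positive (fst s $ l)" "snd s $ m $ l < 0"
    then show "form (fst s $ m) (fst s $ l) = snd s $ m $ l"
      using cases3[of m] cases3[of l] npi fm by (auto simp: s B fc)
  next
    fix m assume "m \<noteq> l" "positive (- (fst s $ l))" "snd s $ m $ l > 0"
    then show "form (fst s $ m) (fst s $ l) = - (snd s $ m $ l)"
      using cases3[of m] cases3[of l] npk fm by (auto simp: s B fc)
  qed
  moreover have "\<exists>i j k. i \<noteq> j \<and> j \<noteq> k \<and> i \<noteq> k \<and> exceptional (fst t $ i) (fst t $ j) (fst t $ k)"
  proof -
    note mv = mutate_vectors_reflect
    have *: ?thesis if "exceptional (fst t $ a) (fst t $ b) (fst t $ c)" "a \<noteq> b" "b \<noteq> c" "a \<noteq> c" for a b c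
      using that by blast
    consider "l = i" | "l = j" "positive (v $ j)" | "l = j" "positive (- (v $ j))" | "l = k"
      using cases3[of l] p by blast
    then show ?thesis
    proof cases
      case 1
      show ?thesis
      proof (cases "form (v $ i) (v $ k) < 0")
        case True
        show ?thesis by (rule *[of j k i])
            (use True exceptional_first_both[OF ex] 1 ne pi npi fm in \<open>simp_all add: t mv B\<close>)
      next
        case False
        with fm have "form (v $ i) (v $ k) > 0" by simp
        then show ?thesis by (intro *[of j i k])
            (use exceptional_first_one[OF ex] 1 ne pi npi fm in \<open>simp_all add: t mv B\<close>)
      qed
    next
      case 2
      then show ?thesis by (intro *[of j i k])
            (use exceptional_middle_pos[OF ex] positive_minus ne fm in \<open>simp_all add: t mv B\<close>)
    next
      case 3
      then have "\<not> positive (v $ j)" using positive_minus[of "v $ j"] by auto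
      with 3 show ?thesis by (intro *[of i k j])
            (use exceptional_middle_neg[OF ex] ne fm in \<open>simp_all add: t mv B\<close>)
    next
      case 4
      show ?thesis
      proof (cases "form (v $ i) (v $ k) < 0")
        case True
        show ?thesis by (rule *[of k i j])
            (use True exceptional_last_both[OF ex] 4 ne pk npk fm in \<open>simp_all add: t mv B\<close>)
      next
        case False
        with fm have "form (v $ i) (v $ k) > 0" by simp
        then show ?thesis by (intro *[of i k j])
            (use exceptional_last_one[OF ex] 4 ne pk npk fm in \<open>simp_all add: t mv B\<close>)
      qed
    qed
  qed
  ultimately show ?thesis by (simp add: belt_seed_def)
qed

lemma belt_seed_relabel:
  assumes "belt_seed s" "bij \<sigma>" shows "belt_seed (relabel \<sigma> s)"
proof -
  obtain i j k where ne: "i \<noteq> j" "j \<noteq> k" "i \<noteq> k"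
    and ex: "exceptional (fst s $ i) (fst s $ j) (fst s $ k)" and comp: "compatible s"
    using assms(1) unfolding belt_seed_def by auto
  have inv: "\<sigma> (inv \<sigma> x) = x" for x using assms(2) by (simp add: bij_is_surj surj_f_inv_f)
  then have "inv \<sigma> i \<noteq> inv \<sigma> j" "inv \<sigma> j \<noteq> inv \<sigma> k" "inv \<sigma> i \<noteq> inv \<sigma> k" using ne by metis+
  moreover have "exceptional (fst (relabel \<sigma> s) $ inv \<sigma> i) (fst (relabel \<sigma> s) $ inv \<sigma> j) (fst (relabel \<sigma> s) $ inv \<sigma> k)"
    using ex by (simp add: relabel_def inv)
  moreover have "compatible (relabel \<sigma> s)" using comp by (simp add: compatible_def relabel_def)
  ultimately show ?thesis unfolding belt_seed_def by blast
qed

lemma belt_seed_root: assumes "belt_seed s" shows "root (fst s $ l)"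
proof -
  obtain i j k where ne: "i \<noteq> j" "j \<noteq> k" "i \<noteq> k"
    and ex: "exceptional (fst s $ i) (fst s $ j) (fst s $ k)"
    using assms unfolding belt_seed_def by auto
  show ?thesis using exhaust_3_distinct[OF ne, of l] ex by (auto simp: exceptional_def)
qed

text \<open>The skew form determines the ratio of the height differences of the two seeds to the sines, so a
  single translation along the belt accounts for all of them.\<close>

lemma belt_seed_same_translate:
  assumes "belt_seed s" "belt_seed t" "snd s = snd t" "\<And>i. fst (fst s $ i) = fst (fst t $ i)"
  shows "\<exists>c. t = translate_labelled (c *\<^sub>R d) s"
proof -
  obtain i k l where "exceptional (fst s $ i) (fst s $ k) (fst s $ l)" using assms(1) by (auto simp: belt_seed_def)
  then have "sine (fst s $ i) \<noteq> 0 \<or> sine (fst s $ l) \<noteq> 0" by (simp add: exceptional_def)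
  then obtain j where j: "sine (fst s $ j) \<noteq> 0" by blast
  have sine: "sine (fst t $ i) = sine (fst s $ i)" for i using assms(4) by (simp add: sine_def)
  define \<delta> where "\<delta> i = height (fst t $ i) - height (fst s $ i)" for i
  have "skew (fst s $ i) (fst s $ j) = skew (fst t $ i) (fst t $ j)" for i
    using assms by (simp add: belt_seed_def compatible_def)
  then have "sine (fst s $ j) * height (fst s $ i) - sine (fst s $ i) * height (fst s $ j) =
       sine (fst s $ j) * height (fst t $ i) - sine (fst s $ i) * height (fst t $ j)" for i
    using \<kappa> unfolding skew_def sine by simp
  then have \<delta>: "\<delta> i = sine (fst s $ i) * (\<delta> j / sine (fst s $ j))" for i
    using j by (simp add: \<delta>_def field_simps)
  define c where "c = \<delta> j / sine (fst s $ j) / sqrt 2"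
  have "fst t $ i = translate_afun (c *\<^sub>R d) (fst s $ i)" for i
  proof -
    have "fst (fst s $ i) \<bullet> d = - sqrt 2 * sine (fst s $ i)" by (simp add: sine_def)
    then have "fst (fst s $ i) \<bullet> (c *\<^sub>R d) = - \<delta> i"
      by (subst \<delta>[of i]) (simp add: c_def)
    moreover have "snd (fst t $ i) = snd (fst s $ i) + \<delta> i"
      using assms(4)[of i] by (simp add: \<delta>_def height_def aeval_def)
    ultimately show ?thesis using assms(4)[of i] by (simp add: translate_afun_def prod_eq_iff)
  qed
  then have "t = translate_labelled (c *\<^sub>R d) s"
    using assms(3) by (simp add: translate_labelled_def vec_eq_iff prod_eq_iff)
  then show ?thesis by blast
qed

text \<open>A translation by \<open>w\<close> changes \<open>skew f g\<close> by a multiple of \<open>w \<bullet> e\<close> times the determinant of the gradients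
  of \<open>f\<close> and \<open>g\<close>. If \<open>w \<bullet> e\<close> were nonzero, all gradients would be parallel, and then the angle relation
  of an exceptional triple forces both outer sines to vanish.\<close>

lemma belt_seed_translate_parallel:
  assumes "belt_seed s" "belt_seed (translate_labelled w s)"
  shows "\<exists>c. w = c *\<^sub>R d"
proof -
  obtain i j k where ne: "i \<noteq> j" "j \<noteq> k" "i \<noteq> k"
    and ex: "exceptional (fst s $ i) (fst s $ j) (fst s $ k)"
    using assms(1) unfolding belt_seed_def by auto
  define T where "T f = translate_afun w f" for f
  have T: "sine (T f) = sine f" "height (T f) = height f + sqrt 2 * sine f * (w \<bullet> d) - sqrt 2 * cosine f * (w \<bullet> e)" for f
  proof -
    show "sine (T f) = sine f" by (simp add: sine_def T_def translate_afun_def)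
    have "fst f \<bullet> w = - sqrt 2 * sine f * (w \<bullet> d) + sqrt 2 * cosine f * (w \<bullet> e)"
      by (subst fst_coords)
        (simp add: inner_add_left inner_diff_left inner_commute[of w d] inner_commute[of w e])
    then show "height (T f) = height f + sqrt 2 * sine f * (w \<bullet> d) - sqrt 2 * cosine f * (w \<bullet> e)"
      by (simp add: height_def aeval_def T_def translate_afun_def)
  qed
  have "skew (T (fst s $ l)) (T (fst s $ m)) = skew (fst s $ l) (fst s $ m)" for l m
    using assms by (simp add: belt_seed_def compatible_def T_def translate_labelled_def)
  then have "(w \<bullet> e) * (sine (fst s $ m) * cosine (fst s $ l) - sine (fst s $ l) * cosine (fst s $ m)) = 0" for l m
    using \<kappa> unfolding skew_def T by (auto simp: algebra_simps)
  then have *: "w \<bullet> e = 0 \<or> sine (fst s $ m) * cosine (fst s $ l) - sine (fst s $ l) * cosine (fst s $ m) = 0" for l m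
    using mult_eq_0_iff by blast
  have "w \<bullet> e = 0"
  proof (rule ccontr)
    assume "w \<bullet> e \<noteq> 0"
    then have ij: "sine (fst s $ j) * cosine (fst s $ i) - sine (fst s $ i) * cosine (fst s $ j) = 0"
      and jk: "sine (fst s $ j) * cosine (fst s $ k) - sine (fst s $ k) * cosine (fst s $ j) = 0" using * by blast+
    obtain \<sigma> where \<sigma>: "\<sigma>\<^sup>2 = 1" and 
      g: "cosine (fst s $ j) = - \<sigma> * (cosine (fst s $ i) * cosine (fst s $ k) - sine (fst s $ i) * sine (fst s $ k))"
      "sine (fst s $ j) = - \<sigma> * (sine (fst s $ i) * cosine (fst s $ k) + cosine (fst s $ i) * sine (fst s $ k))"
      and u: "(cosine (fst s $ i))\<^sup>2 + (sine (fst s $ i))\<^sup>2 = 1" "(cosine (fst s $ k))\<^sup>2 + (sine (fst s $ k))\<^sup>2 = 1"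
      by (rule exceptional_balanced[OF ex])
    have "\<sigma> \<noteq> 0" using \<sigma> by auto
    have "sine (fst s $ j) * cosine (fst s $ i) - sine (fst s $ i) * cosine (fst s $ j) =
        - \<sigma> * sine (fst s $ k) * ((cosine (fst s $ i))\<^sup>2 + (sine (fst s $ i))\<^sup>2)"
      unfolding g by (simp add: algebra_simps power2_eq_square)
    then have "sine (fst s $ k) = 0" using ij u \<open>\<sigma> \<noteq> 0\<close> by simp
    moreover have "sine (fst s $ j) * cosine (fst s $ k) - sine (fst s $ k) * cosine (fst s $ j) =
        - \<sigma> * sine (fst s $ i) * ((cosine (fst s $ k))\<^sup>2 + (sine (fst s $ k))\<^sup>2)"
      unfolding g by (simp add: algebra_simps power2_eq_square)
    then have "sine (fst s $ i) = 0" using jk u \<open>\<sigma> \<noteq> 0\<close> by simp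
    ultimately show False using ex by (simp add: exceptional_def)
  qed
  have "w = (w \<bullet> d) *\<^sub>R d"
  proof -
    let ?z = "w - (w \<bullet> d) *\<^sub>R d"
    have "?z \<bullet> d = 0" "?z \<bullet> e = 0" using orthonormal \<open>w \<bullet> e = 0\<close> by (simp_all add: inner_diff_left)
    then have "?z \<bullet> ?z = 0" by (subst inner_expand) simp
    then show ?thesis by simp
  qed
  then show ?thesis by blast
qed

lemma positive_translate: "positive (translate_afun (c *\<^sub>R d) f) \<longleftrightarrow> positive f"
  by (auto simp: positive_def sine_def height_def translate_afun_def aeval_def)

lemma finite_root_gradients: "finite {fst f | f. root f}"
proof -
  have "{fst f | f. root f} \<subseteq> (\<lambda>(x, y). (- sqrt 2 * y) *\<^sub>R d + (sqrt 2 * x) *\<^sub>R e) ` {(cosine f, sine f) | f. root f}"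
    using fst_coords by force
  then show ?thesis by (rule finite_subset) (use finite_root_angles in simp)
qed

text \<open>The data of a labelled seed that are invariant under translation.\<close>

definition shape :: "labelled_seed \<Rightarrow> ((real^2)^3) \<times> (real^3^3)" where
  "shape s = (\<chi> i. fst (fst s $ i), snd s)"

lemma finite_shapes: "finite (shape ` {s. belt_seed s})"
proof -
  let ?G = "{fst f | f. root f}"
  define E where "E = insert 0 ((\<lambda>(a, b). a \<bullet> b) ` (?G \<times> ?G) \<union> (\<lambda>(a, b). - (a \<bullet> b)) ` (?G \<times> ?G))"
  have finE: "finite E" unfolding E_def using finite_root_gradients by auto
  have inE: "skew f g \<in> E" if "root f" "root g" "ordered f g \<or> ordered g f \<or> f = g" for f g
  proof -
    have "(fst f, fst g) \<in> ?G \<times> ?G" using that(1,2) by blast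
    then have E: "form f g \<in> E" "- form f g \<in> E" "0 \<in> E"
      unfolding E_def form_def by (force simp del: mem_Sigma_iff)+
    have "skew f g = form f g \<or> skew f g = - form f g \<or> skew f g = 0"
      using that(3) skew_swap[of f g] form_commute[of f g] by (auto simp: ordered_def)
    then show ?thesis using E by metis
  qed
  have "shape ` {s. belt_seed s} \<subseteq> {v. \<forall>i. v $ i \<in> ?G} \<times> {B. \<forall>i. B $ i \<in> {r. \<forall>j. r $ j \<in> E}}"
  proof (rule image_subsetI)
    fix s assume "s \<in> {s. belt_seed s}"
    then have s: "belt_seed s" by simp
    obtain i j k where ne: "i \<noteq> j" "j \<noteq> k" "i \<noteq> k"
      and ex: "exceptional (fst s $ i) (fst s $ j) (fst s $ k)" and comp: "compatible s"
      using s unfolding belt_seed_def by auto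
    have "ordered (fst s $ l) (fst s $ m) \<or> ordered (fst s $ m) (fst s $ l) \<or> fst s $ l = fst s $ m" for l m
      using ex exhaust_3_distinct[OF ne, of l] exhaust_3_distinct[OF ne, of m]
      unfolding exceptional_def by metis
    then have "snd s $ l $ m \<in> E" for l m
      using inE[OF belt_seed_root[OF s] belt_seed_root[OF s], of l m] comp by (simp add: compatible_def)
    moreover have gradients: "fst (fst s $ l) \<in> ?G" for l using belt_seed_root[OF s] by blast
    ultimately show "shape s \<in> {v. \<forall>i. v $ i \<in> ?G} \<times> {B. \<forall>i. B $ i \<in> {r. \<forall>j. r $ j \<in> E}}"
      using gradients by (simp add: shape_def)
  qed
  then show ?thesis
    by (rule finite_subset) (intro finite_cartesian_product finite_vec finite_root_gradients finE)
qed


section \<open>The translation action on the exchange graph\<close>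

lemma belt_seed_seed_of: "belt_seed s \<Longrightarrow> seed_of t = seed_of s \<Longrightarrow> belt_seed t"
  using belt_seed_relabel by (metis seed_of_eqD)

lemma seed_mutations_belt_seed:
  assumes "belt_seed s" "(seed_of s, D) \<in> seed_mutations positive"
  shows "(D, seed_of s) \<in> seed_mutations positive" "\<exists>t. belt_seed t \<and> D = seed_of t"
proof -
  obtain s' t k where st: "seed_of s = seed_of s'" "D = seed_of t" "mutation positive k s' t"
    using assms(2) unfolding seed_mutations_def by auto
  have s': "belt_seed s'" using belt_seed_seed_of[OF assms(1)] st(1) by simp
  have "mutation positive k t s'" by (rule mutation_sym[OF st(3) root_norm[OF belt_seed_root[OF s']]])
  then show "(D, seed_of s) \<in> seed_mutations positive" unfolding seed_mutations_def using st(1,2) by blast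
  show "\<exists>t. belt_seed t \<and> D = seed_of t" using belt_seed_mutation[OF s' st(3)] st(2) by blast
qed

lemma exchange_vertices_belt_seed:
  assumes "belt_seed s" "C \<in> exchange_vertices positive s"
  shows "\<exists>t. belt_seed t \<and> C = seed_of t"
proof -
  have "(seed_of s, C) \<in> (seed_mutations positive)\<^sup>*" using assms(2) by (simp add: exchange_vertices_def)
  then show ?thesis
  proof induction
    case base
    then show ?case using assms(1) by blast
  next
    case (step C D)
    then show ?case using seed_mutations_belt_seed(2) by blast
  qed
qed

lemma seed_mutations_translate:
  assumes "(C, D) \<in> seed_mutations positive"
  shows "(translate_seed (c *\<^sub>R d) C, translate_seed (c *\<^sub>R d) D) \<in> seed_mutations positive"
proof -
  obtain s t k where st: "C = seed_of s" "D = seed_of t" "mutation positive k s t"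
    using assms unfolding seed_mutations_def by auto
  have "mutation positive k (translate_labelled (c *\<^sub>R d) s) (translate_labelled (c *\<^sub>R d) t)"
    by (rule mutation_translate[OF st(3) positive_translate])
  then show ?thesis unfolding st(1,2) translate_seed_of seed_mutations_def by blast
qed

text \<open>The sum of \<open>sine * height\<close> over the three vectors does not depend on the labelling, and a
  translation along the belt by \<open>c\<close> changes it by \<open>c\<close> times a positive number. This excludes a
  translation that permutes the sides.\<close>

lemma translate_seed_free:
  assumes "belt_seed s" "translate_seed (c *\<^sub>R d) (seed_of s) = seed_of s"
  shows "c = 0"
proof -
  obtain \<sigma> where \<sigma>: "bij \<sigma>" "translate_labelled (c *\<^sub>R d) s = relabel \<sigma> s"
    using assms(2) unfolding translate_seed_of by (rule seed_of_eqD)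
  let ?v = "fst s"
  let ?q = "\<lambda>f. sine f * height f"
  have shift: "translate_afun (c *\<^sub>R d) (?v $ i) = ?v $ \<sigma> i" for i
    using \<sigma>(2) by (simp add: translate_labelled_def relabel_def vec_eq_iff)
  have *: "?q (translate_afun (c *\<^sub>R d) f) = ?q f + sqrt 2 * c * (sine f)\<^sup>2" for f
  proof -
    have "fst f \<bullet> d = - sqrt 2 * sine f" by (simp add: sine_def)
    then have "height (translate_afun (c *\<^sub>R d) f) = height f + sqrt 2 * c * sine f"
      by (simp add: height_def translate_afun_def aeval_def)
    moreover have "sine (translate_afun (c *\<^sub>R d) f) = sine f" by (simp add: sine_def translate_afun_def)
    ultimately show ?thesis by (simp add: algebra_simps power2_eq_square)
  qed
  have "(\<Sum>i\<in>UNIV. ?q (?v $ i)) = (\<Sum>i\<in>UNIV. ?q (?v $ \<sigma> i))"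
    by (rule sum.reindex_bij_betw[OF \<sigma>(1), symmetric])
  also have "\<dots> = (\<Sum>i\<in>UNIV. ?q (?v $ i) + sqrt 2 * c * (sine (?v $ i))\<^sup>2)"
    unfolding shift[symmetric] * ..
  also have "\<dots> = (\<Sum>i\<in>UNIV. ?q (?v $ i)) + sqrt 2 * c * (\<Sum>i\<in>UNIV. (sine (?v $ i))\<^sup>2)"
    by (simp add: sum.distrib sum_distrib_left)
  finally have "c = 0 \<or> (\<Sum>i\<in>UNIV. (sine (?v $ i))\<^sup>2) = 0" by simp
  moreover have "(\<Sum>i\<in>UNIV. (sine (?v $ i))\<^sup>2) \<noteq> 0"
  proof
    assume "(\<Sum>i\<in>UNIV. (sine (?v $ i))\<^sup>2) = 0"
    then have "sine (?v $ i) = 0" for i by (simp add: sum_nonneg_eq_0_iff)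
    moreover obtain i j k where "exceptional (?v $ i) (?v $ j) (?v $ k)" using assms(1) by (auto simp: belt_seed_def)
    ultimately show False by (simp add: exceptional_def)
  qed
  ultimately show ?thesis by blast
qed

lemma finite_neighbours:
  assumes "belt_seed s" shows "finite (seed_mutations positive `` {seed_of s})"
proof -
  have "seed_mutations positive `` {seed_of s} \<subseteq>
     (\<lambda>(s, k). seed_of (mutate_vectors positive k (fst s) (snd s), mutate_matrix k (snd s))) ` (seed_of s \<times> UNIV)"
    unfolding seed_mutations_def mutation_def using seed_of_self by fastforce
  then show ?thesis by (rule finite_subset) (simp add: finite_seed_of)
qed

text \<open>The translations between seeds already form a group: since mutation is symmetric and commutes with
  translations along the belt, a translation taking one vertex to a vertex maps the whole graph
  to itself. It has finitely many orbits because two seeds of equal shape differ by such a translation.\<close>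

theorem exchange_graph_quasi_isometric:
  assumes s: "belt_seed s"
  defines "V \<equiv> exchange_vertices positive s" and "E \<equiv> exchange_edges positive s"
    and "L \<equiv> translation_lattice positive s"
  shows "(\<exists>S. finite_symmetric_generators S L) \<and>
    (\<forall>S. finite_symmetric_generators S L \<longrightarrow>
      quasi_isometry L (graph_dist (cayley_edges L S)) V (graph_dist E)
        (\<lambda>w. translate_seed w (seed_of s)))"
proof -
  let ?M = "seed_mutations positive" and ?x = "seed_of s" and ?T = translate_seed
  have V: "C \<in> V \<longleftrightarrow> (?x, C) \<in> ?M\<^sup>*" for C by (simp add: V_def exchange_vertices_def)
  have xV: "?x \<in> V" by (simp add: V)
  have Vgood: "\<exists>t. belt_seed t \<and> C = seed_of t" if "C \<in> V" for C
    using exchange_vertices_belt_seed[OF s] that unfolding V_def .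
  have Msym: "(D, C) \<in> ?M" if "C \<in> V" "(C, D) \<in> ?M" for C D
    using Vgood[OF that(1)] seed_mutations_belt_seed(1) that(2) by blast
  have to_base: "(C, ?x) \<in> ?M\<^sup>*" if "C \<in> V" for C
    using that unfolding V
  proof induction
    case (step C D)
    then have "(D, C) \<in> ?M" using Msym V by blast
    then show ?case using step.IH by (rule converse_rtrancl_into_rtrancl)
  qed simp
  have shiftM: "(?T (c *\<^sub>R d) C, ?T (c *\<^sub>R d) D) \<in> ?M\<^sup>*" if "(C, D) \<in> ?M\<^sup>*" for c C D
    using that by induction (auto intro: rtrancl_into_rtrancl seed_mutations_translate)
  define W where "W = {w. \<exists>C \<in> V. ?T w C \<in> V}"
  have parallel: "\<exists>c. w = c *\<^sub>R d" if w: "w \<in> W" for w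
  proof -
    obtain C where C: "C \<in> V" "?T w C \<in> V" using w by (auto simp: W_def)
    obtain t where t: "belt_seed t" "C = seed_of t" using Vgood[OF C(1)] by blast
    obtain t' where "belt_seed t'" "seed_of (translate_labelled w t) = seed_of t'"
      using Vgood[OF C(2)] unfolding t(2) translate_seed_of by blast
    then show ?thesis using belt_seed_translate_parallel[OF t(1)] belt_seed_seed_of by blast
  qed
  have WV: "?T w D \<in> V" if w: "w \<in> W" and D: "D \<in> V" for w D
  proof -
    obtain c where c: "w = c *\<^sub>R d" using parallel[OF w] by blast
    obtain C where C: "C \<in> V" "?T w C \<in> V" using w by (auto simp: W_def)
    have "(?x, ?T w C) \<in> ?M\<^sup>*" using C(2) by (simp add: V)
    also have "(?T w C, ?T w ?x) \<in> ?M\<^sup>*" unfolding c by (rule shiftM[OF to_base[OF C(1)]])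
    also have "(?T w ?x, ?T w D) \<in> ?M\<^sup>*" unfolding c using D by (intro shiftM) (simp add: V)
    finally show ?thesis by (simp add: V)
  qed
  have W0: "0 \<in> W" using xV by (auto simp: W_def translate_seed_0)
  have Wminus: "- w \<in> W" if "w \<in> W" for w
  proof -
    have "?T (- w) (?T w ?x) = ?x" using translate_seed_add[of "- w" w ?x] by (simp add: translate_seed_0)
    then show ?thesis using WV[OF that xV] xV unfolding W_def by (intro CollectI bexI[of _ "?T w ?x"]) auto
  qed
  have Wdiff: "v - w \<in> W" if "v \<in> W" "w \<in> W" for v w
  proof -
    have "?T (v - w) ?x = ?T v (?T (- w) ?x)" using translate_seed_add[of v "- w" ?x] by simp
    then have "?T (v - w) ?x \<in> V" using WV[OF that(1) WV[OF Wminus[OF that(2)] xV]] by simp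
    then show ?thesis using xV by (auto simp: W_def)
  qed
  \<comment> \<open>\<open>W\<close> is a group, so nothing is added by passing to the generated module.\<close>
  have LW: "L = W"
  proof
    have L: "L = group_closure W" by (simp add: L_def translation_lattice_def W_def V_def)
    show "L \<subseteq> W" unfolding L by (rule group_closure_closed[OF W0 Wdiff]) auto
    show "W \<subseteq> L" unfolding L by (auto intro: group_closure.base)
  qed
  have E: "(C, D) \<in> E \<longleftrightarrow> C \<in> V \<and> D \<in> V \<and> (C, D) \<in> ?M" for C D
    using Msym by (auto simp: E_def exchange_edges_def V_def)
  have fin: "finite (shape ` {t. belt_seed t \<and> seed_of t \<in> V})"
    by (rule finite_subset[OF _ finite_shapes]) auto
  \<comment> \<open>One representative for each of the finitely many shapes.\<close>
  obtain K where K: "K \<subseteq> {t. belt_seed t \<and> seed_of t \<in> V}" "finite K"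
    "shape ` {t. belt_seed t \<and> seed_of t \<in> V} = shape ` K"
    using finite_subset_image[OF fin subset_refl] by blast
  show ?thesis
  proof (rule milnor_svarc_graph[where K = "seed_of ` K" and T = ?T and V = V])
    show "0 \<in> L" using W0 LW by simp
    show "v - w \<in> L" if "v \<in> L" "w \<in> L" for v w using Wdiff that LW by simp
    show "?x \<in> V" "E \<subseteq> V \<times> V" "sym E" using xV E Msym by (auto simp: sym_def)
    show "(?x, C) \<in> E\<^sup>*" if "C \<in> V" for C
      using that unfolding V
    proof induction
      case (step C D)
      then have "(C, D) \<in> E" using rtrancl_into_rtrancl[OF step(1,2)] by (simp add: E V)
      with step.IH show ?case by (rule rtrancl_into_rtrancl)
    qed simp
    show "finite (E `` {C})" for C
    proof (cases "C \<in> V")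
      case True
      then obtain t where "belt_seed t" "C = seed_of t" using Vgood by blast
      then have "finite (?M `` {C})" using finite_neighbours by blast
      then show ?thesis by (rule finite_subset[rotated]) (auto simp: E)
    next
      case False
      then have "E `` {C} = {}" by (auto simp: E)
      then show ?thesis by simp
    qed
    show "(?T w C, ?T w D) \<in> E" if w: "w \<in> L" and CD: "(C, D) \<in> E" for w C D
    proof -
      obtain c where c: "w = c *\<^sub>R d" using parallel w LW by blast
      have "(?T w C, ?T w D) \<in> ?M" unfolding c by (rule seed_mutations_translate) (use CD E in simp)
      then show ?thesis using WV w CD by (simp add: E LW)
    qed
    show "w = 0" if w: "w \<in> L" "?T w ?x = ?x" for w
    proof -
      obtain c where "w = c *\<^sub>R d" using parallel w(1) LW by blast
      then show ?thesis using translate_seed_free[OF s] w(2) by simp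
    qed
    show "\<exists>w \<in> L. \<exists>D \<in> seed_of ` K. C = ?T w D" if C: "C \<in> V" for C
    proof -
      obtain t where t: "belt_seed t" "C = seed_of t" using Vgood[OF C] by blast
      then have "shape t \<in> shape ` K" using K(3) C by blast
      then obtain u where u: "u \<in> K" "shape u = shape t" by auto
      then have u': "belt_seed u" "seed_of u \<in> V" using K(1) by auto
      have "snd u = snd t" "\<And>i. fst (fst u $ i) = fst (fst t $ i)"
        using u(2) by (simp_all add: shape_def vec_eq_iff)
      then obtain c where c: "t = translate_labelled (c *\<^sub>R d) u"
        using belt_seed_same_translate[OF u'(1) t(1)] by blast
      then have "C = ?T (c *\<^sub>R d) (seed_of u)" unfolding translate_seed_of t(2) by simp
      moreover from this have "c *\<^sub>R d \<in> L" unfolding LW W_def using C u'(2) by blast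
      ultimately show ?thesis using u(1) by blast
    qed
    show "finite (seed_of ` K)" "seed_of ` K \<subseteq> V" using K(1,2) by auto
    show "?T w C \<in> V" if "w \<in> L" "C \<in> V" for w C using WV that by (simp add: LW)
  qed (rule translate_seed_0 translate_seed_add)+
qed

end

section \<open>The initial triangle\<close>

text \<open>Orienting the second axis towards \<open>Z\<close> makes both orientations of the triangle look alike.\<close>

lemma plane_frame:
  fixes X Y Z :: "real^2"
  assumes "\<not> collinear {X, Y, Z}"
  obtains u w :: "real^2" where "u \<bullet> u = 1" "w \<bullet> w = 1" "u \<bullet> w = 0"
    "\<And>x y. x \<bullet> y = (x \<bullet> u) * (y \<bullet> u) + (x \<bullet> w) * (y \<bullet> w)"
    "Y - X = norm (Y - X) *\<^sub>R u" "norm (Y - X) > 0" "(Z - X) \<bullet> w > 0"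
proof -
  have "X \<noteq> Y" using assms by auto
  define c where "c = norm (Y - X)"
  have c: "c > 0" using \<open>X \<noteq> Y\<close> by (simp add: c_def)
  define u where "u = (Y - X) /\<^sub>R c"
  have uu: "u \<bullet> u = 1" 
  proof -
    have "norm u = 1" using c unfolding u_def by (simp add: c_def)
    then show ?thesis by (simp add: dot_square_norm)
  qed
  have Y: "Y - X = c *\<^sub>R u" using c by (simp add: u_def)
  define p q where "p = u $ 1" and "q = u $ 2"
  have pq: "p\<^sup>2 + q\<^sup>2 = 1" using uu by (simp add: inner_vec_def sum_2 p_def q_def power2_eq_square)
  define r :: "real^2" where "r = vector [- q, p]"
  have r: "r $ 1 = - q" "r $ 2 = p" by (simp_all add: r_def)
  have ux: "x \<bullet> u = x $ 1 * p + x $ 2 * q" for x by (simp add: inner_vec_def sum_2 p_def q_def)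
  have rx: "x \<bullet> r = x $ 2 * p - x $ 1 * q" for x by (simp add: inner_vec_def sum_2 r)
  have expand: "x \<bullet> y = (x \<bullet> u) * (y \<bullet> u) + (x \<bullet> r) * (y \<bullet> r)" for x y
  proof -
    have "x \<bullet> y = x $ 1 * y $ 1 + x $ 2 * y $ 2" by (simp add: inner_vec_def sum_2)
    then show ?thesis unfolding ux rx using pq by algebra
  qed
  have rr: "r \<bullet> r = 1" "u \<bullet> r = 0" using pq by (simp_all add: rx r p_def[symmetric] q_def[symmetric] power2_eq_square)
  have ne: "(Z - X) \<bullet> r \<noteq> 0"
  proof
    assume 0: "(Z - X) \<bullet> r = 0"
    let ?z = "(Z - X) - ((Z - X) \<bullet> u) *\<^sub>R u"
    have "?z \<bullet> u = 0" "?z \<bullet> r = 0" using 0 uu rr by (simp_all only: inner_diff_left inner_scaleR_left) auto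
    then have "?z \<bullet> ?z = 0" by (subst expand) simp
    then have "Z - X = ((Z - X) \<bullet> u) *\<^sub>R u" by simp
    then obtain k where "Z - X = k *\<^sub>R u" by blast
    also have "\<dots> = (k / c) *\<^sub>R (Y - X)" using c by (simp add: Y)
    finally have "Z = (k / c) *\<^sub>R Y + (1 - k / c) *\<^sub>R X" by (simp add: algebra_simps)
    then have "collinear {Y, Z, X}" unfolding collinear_3_expand by blast
    then have "collinear {X, Y, Z}" by (simp add: insert_commute)
    then show False using assms by simp
  qed
  define w where "w = sgn ((Z - X) \<bullet> r) *\<^sub>R r"
  have sg: "sgn ((Z - X) \<bullet> r) * sgn ((Z - X) \<bullet> r) = 1" using ne by (simp add: sgn_if)
  have xw: "x \<bullet> w = sgn ((Z - X) \<bullet> r) * (x \<bullet> r)" for x by (simp add: w_def)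
  show thesis
  proof (rule that[OF uu])
    show "w \<bullet> w = 1" using sg rr by (simp add: w_def)
    show "u \<bullet> w = 0" using rr by (simp add: xw)
    show "x \<bullet> y = (x \<bullet> u) * (y \<bullet> u) + (x \<bullet> w) * (y \<bullet> w)" for x y
      unfolding xw expand[of x y] using sg by algebra
    show "Y - X = norm (Y - X) *\<^sub>R u" "norm (Y - X) > 0" using Y c by (simp_all add: c_def)
    show "(Z - X) \<bullet> w > 0" unfolding xw using ne by (simp add: sgn_if)
  qed
qed

lemma cos_angle_at: "norm (P - A) * norm (Q - A) * cos (angle_at A P Q) = (P - A) \<bullet> (Q - A)"
proof (cases "P = A \<or> Q = A")
  case False
  then have pos: "norm (P - A) * norm (Q - A) > 0" by simp
  then have "\<bar>(P - A) \<bullet> (Q - A) / (norm (P - A) * norm (Q - A))\<bar> \<le> 1"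
    using Cauchy_Schwarz_ineq2[of "P - A" "Q - A"] by (simp add: abs_mult divide_le_eq)
  then have "cos (angle_at A P Q) = (P - A) \<bullet> (Q - A) / (norm (P - A) * norm (Q - A))"
    unfolding angle_at_def by (simp add: cos_arccos_abs)
  then show ?thesis using pos by simp
qed auto

text \<open>The foot on the base is its midpoint. The triangle with vertices \<open>Y\<close> and the two feet is similar to
  \<open>XYZ\<close>, whence \<open>FG\<close> is as long as half the base and makes the angle \<open>\<pi> - 2 \<beta>\<close>, the angle at
  \<open>Z\<close>, with it.\<close>

lemma isosceles_frame:
  fixes X Y Z F G :: "real^2"
  assumes tri: "\<not> collinear {X, Y, Z}"
    and angX: "angle_at X Y Z = \<beta>" and angY: "angle_at Y X Z = \<beta>"
    and \<beta>: "0 < \<beta>" "\<beta> < pi / 2"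
    and F: "altitude_foot F Z X Y" and G: "altitude_foot G X Y Z"
  obtains u w :: "real^2" and a b :: real where "u \<bullet> u = 1" "w \<bullet> w = 1" "u \<bullet> w = 0"
    "\<forall>x y. x \<bullet> y = (x \<bullet> u) * (y \<bullet> u) + (x \<bullet> w) * (y \<bullet> w)"
    "a > 0" "b > 0" "b * cos \<beta> = a * sin \<beta>"
    "Y = X + (2 * a) *\<^sub>R u" "Z = X + a *\<^sub>R u + b *\<^sub>R w" "F = X + a *\<^sub>R u"
    "G = F + a *\<^sub>R (- cos (2 * \<beta>) *\<^sub>R u + sin (2 * \<beta>) *\<^sub>R w)"
proof -
  obtain u w :: "real^2" where o: "u \<bullet> u = 1" "w \<bullet> w = 1" "u \<bullet> w = 0"
    and expand: "\<And>x y. x \<bullet> y = (x \<bullet> u) * (y \<bullet> u) + (x \<bullet> w) * (y \<bullet> w)"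
    and YX: "Y - X = norm (Y - X) *\<^sub>R u" "norm (Y - X) > 0" and Zw: "(Z - X) \<bullet> w > 0"
    using plane_frame[OF tri] by metis
  have o': "w \<bullet> u = 0" using o by (simp add: inner_commute)
  define c where "c = norm (Y - X)"
  define a where "a = (Z - X) \<bullet> u"
  define b where "b = (Z - X) \<bullet> w"
  have c: "c > 0" and Y: "Y = X + c *\<^sub>R u" using YX by (auto simp: c_def algebra_simps)
  have b: "b > 0" using Zw by (simp add: b_def)
  have Z: "Z = X + a *\<^sub>R u + b *\<^sub>R w"
  proof -
    let ?z = "Z - (X + a *\<^sub>R u + b *\<^sub>R w)"
    have "?z \<bullet> u = 0" "?z \<bullet> w = 0"
      using o o' by (simp_all add: a_def b_def inner_diff_left inner_add_left)
    then have "?z \<bullet> ?z = 0" by (subst expand) simp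
    then show ?thesis by simp
  qed
  have ZX: "Z - X = a *\<^sub>R u + b *\<^sub>R w" and ZY: "Z - Y = (a - c) *\<^sub>R u + b *\<^sub>R w" and XY: "X - Y = (- c) *\<^sub>R u"
    and YX': "Y - X = c *\<^sub>R u"
    by (simp_all add: Z Y algebra_simps)
  have dot: "(x1 *\<^sub>R u + x2 *\<^sub>R w) \<bullet> (y1 *\<^sub>R u + y2 *\<^sub>R w) = x1 * y1 + x2 * y2" for x1 x2 y1 y2
    using o o' by (simp add: inner_add_left inner_add_right)
  have cs: "cos \<beta> > 0" "sin \<beta> > 0" using \<beta> by (auto intro: cos_gt_zero sin_gt_zero)
  have nrm: "norm (x1 *\<^sub>R u + x2 *\<^sub>R w) = sqrt (x1\<^sup>2 + x2\<^sup>2)" for x1 x2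
    by (simp add: norm_eq_sqrt_inner dot power2_eq_square)
  have nu: "norm u = 1" using o by (simp add: norm_eq_sqrt_inner)
  have key: "x > 0 \<and> x * sin \<beta> = b * cos \<beta>" if "sqrt (x\<^sup>2 + b\<^sup>2) * cos \<beta> = x" for x
  proof -
    have sq: "sqrt (x\<^sup>2 + b\<^sup>2) > 0" using b by (simp add: add_nonneg_pos)
    then have x: "x > 0" using that cs by (metis mult_pos_pos)
    have "(x\<^sup>2 + b\<^sup>2) * (cos \<beta>)\<^sup>2 = x\<^sup>2"
      using that by (metis power_mult_distrib real_sqrt_pow2 sum_power2_ge_zero)
    then have "(x * sin \<beta>)\<^sup>2 = (b * cos \<beta>)\<^sup>2"
      using sin_cos_squared_add[of \<beta>] by algebra
    then have "x * sin \<beta> = b * cos \<beta>" using x b cs by (simp add: power2_eq_iff_nonneg)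
    with x show ?thesis by simp
  qed
  have "c * norm (Z - X) * cos \<beta> = c * a"
    using cos_angle_at[of Y X Z] o o' c nu unfolding angX YX' ZX by (simp add: inner_add_right)
  then have "sqrt (a\<^sup>2 + b\<^sup>2) * cos \<beta> = a" using c by (simp add: ZX nrm)
  then have a: "a > 0" "a * sin \<beta> = b * cos \<beta>" using key by auto
  have "c * norm (Z - Y) * cos \<beta> = c * (c - a)"
    using cos_angle_at[of X Y Z] o o' c nu unfolding angY XY ZY by (simp add: inner_add_right algebra_simps)
  then have "sqrt ((c - a)\<^sup>2 + b\<^sup>2) * cos \<beta> = c - a" using c by (simp add: ZY nrm power2_commute)
  then have "(c - a) * sin \<beta> = b * cos \<beta>" using key by auto
  then have ca: "c = 2 * a" using a cs by (metis add_diff_cancel_right' diff_add_cancel less_irrefl mult_2 mult_right_cancel)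
  obtain t where t: "F = X + t *\<^sub>R (Y - X)"
    using F unfolding altitude_foot_def affine_hull_2_alt by auto
  have ZF: "Z - F = (a - t * c) *\<^sub>R u + b *\<^sub>R w" by (simp add: t YX' Z algebra_simps)
  have YX0: "Y - X = c *\<^sub>R u + 0 *\<^sub>R w" by (simp add: YX')
  have "(Z - F) \<bullet> (Y - X) = 0" using F by (simp add: altitude_foot_def orthogonal_def)
  then have "(a - t * c) * c + b * 0 = 0" unfolding ZF YX0 dot .
  then have tc: "t * c = a" using c by auto
  have FX: "F = X + a *\<^sub>R u" using tc by (simp add: t YX')
  obtain s where s: "G = Y + s *\<^sub>R (Z - Y)"
    using G unfolding altitude_foot_def affine_hull_2_alt by auto
  have XG: "X - G = (s * a - 2 * a) *\<^sub>R u + (- s * b) *\<^sub>R w"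
    and ZY': "Z - Y = (- a) *\<^sub>R u + b *\<^sub>R w"
    by (simp_all add: vec_eq_iff s Y Z ca algebra_simps)
  have "(X - G) \<bullet> (Z - Y) = 0" using G by (simp add: altitude_foot_def orthogonal_def)
  then have "(s * a - 2 * a) * - a + (- s * b) * b = 0" unfolding XG ZY' dot .
  then have "s * (a\<^sup>2 + b\<^sup>2) = 2 * a\<^sup>2" by (simp add: algebra_simps power2_eq_square)
  then have "s * a\<^sup>2 = 2 * a\<^sup>2 * (cos \<beta>)\<^sup>2" using a(2) sin_cos_squared_add[of \<beta>] by algebra
  then have sc: "s = 2 * (cos \<beta>)\<^sup>2" using a by simp
  have e1: "a * - cos (2 * \<beta>) = a - s * a" unfolding sc cos_double_cos by (simp add: algebra_simps)
  have e2: "a * sin (2 * \<beta>) = s * b" unfolding sin_double sc using a(2) by (simp add: power2_eq_square)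
  have "F + a *\<^sub>R (- cos (2 * \<beta>) *\<^sub>R u + sin (2 * \<beta>) *\<^sub>R w) = F + (a * - cos (2 * \<beta>)) *\<^sub>R u + (a * sin (2 * \<beta>)) *\<^sub>R w"
    by (simp add: scaleR_diff_right)
  also have "\<dots> = F + a *\<^sub>R u + s *\<^sub>R ((- a) *\<^sub>R u + b *\<^sub>R w)"
    unfolding e1 e2 by (simp add: scaleR_left_diff_distrib scaleR_diff_right)
  also have "\<dots> = G"
  proof -
    have "F + a *\<^sub>R u = Y" unfolding FX Y ca mult_2 scaleR_left_distrib by simp
    then show ?thesis unfolding s ZY' by simp
  qed
  finally have G': "G = F + a *\<^sub>R (- cos (2 * \<beta>) *\<^sub>R u + sin (2 * \<beta>) *\<^sub>R w)" ..
  have Y': "Y = X + (2 * a) *\<^sub>R u" using Y unfolding ca .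
  show thesis by (rule that[OF o _ a(1) b a(2)[symmetric] Y' Z FX G']) (use expand in blast)
qed


lemma centroid_in_interior:
  fixes X Y Z :: "real^2"
  assumes "\<not> collinear {X, Y, Z}"
  shows "(1/3) *\<^sub>R X + (1/3) *\<^sub>R Y + (1/3) *\<^sub>R Z \<in> interior (convex hull {X, Y, Z})"
proof -
  have "DIM(real^2) = 2" by simp
  then show ?thesis
    unfolding interior_convex_hull_3_minimal[OF assms, OF \<open>DIM(real^2) = 2\<close>] mem_Collect_eq
    by (intro exI[of _ "1/3 :: real"]) simp
qed

lemma aeval_convex3:
  assumes "a + b + c = 1"
  shows "aeval f (a *\<^sub>R x + b *\<^sub>R y + c *\<^sub>R z) = a * aeval f x + b * aeval f y + c * aeval f z"
proof -
  have "aeval f (a *\<^sub>R x + b *\<^sub>R y + c *\<^sub>R z) =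
      a * aeval f x + b * aeval f y + c * aeval f z + (1 - (a + b + c)) * snd f"
    by (simp add: aeval_def inner_add_right algebra_simps)
  then show ?thesis using assms by simp
qed

lemma aeval_add: "aeval f (x + y) = aeval f x + fst f \<bullet> y"
  by (simp add: aeval_def inner_add_right)

lemma initial_seed_sides:
  assumes "initial_seed X Y Z s" "\<not> collinear {X, Y, Z}"
  shows "aeval (fst s $ 1) X = 0" "aeval (fst s $ 1) Y = 0" "aeval (fst s $ 1) Z < 0"
    "aeval (fst s $ 2) X = 0" "aeval (fst s $ 2) Z = 0" "aeval (fst s $ 2) Y < 0"
    "aeval (fst s $ 3) Y = 0" "aeval (fst s $ 3) Z = 0" "aeval (fst s $ 3) X < 0"
proof -
  have on: "aeval f P = 0" if "zero_line f = affine hull S" "P \<in> S" for f P S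
  proof -
    have "P \<in> zero_line f" unfolding that(1) by (rule hull_inc[OF that(2)])
    then show ?thesis by (simp add: zero_line_def)
  qed
  show z: "aeval (fst s $ 1) X = 0" "aeval (fst s $ 1) Y = 0"
    "aeval (fst s $ 2) X = 0" "aeval (fst s $ 2) Z = 0"
    "aeval (fst s $ 3) Y = 0" "aeval (fst s $ 3) Z = 0"
    using assms(1) by (auto simp: initial_seed_def intro!: on)
  have "(1/3) *\<^sub>R X + (1/3) *\<^sub>R Y + (1/3) *\<^sub>R Z \<in> seed_domain s"
    using centroid_in_interior[OF assms(2)] assms(1) by (simp add: initial_seed_def)
  then have neg: "aeval (fst s $ i) ((1/3) *\<^sub>R X + (1/3) *\<^sub>R Y + (1/3) *\<^sub>R Z) < 0" for i
    unfolding seed_domain_def half_plane_def by blast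
  have "aeval (fst s $ i) X + aeval (fst s $ i) Y + aeval (fst s $ i) Z < 0" for i
    using neg[of i] aeval_convex3[of "1/3" "1/3" "1/3" "fst s $ i" X Y Z] by linarith
  from this[of 1] this[of 2] this[of 3] z
  show "aeval (fst s $ 1) Z < 0" "aeval (fst s $ 2) Y < 0" "aeval (fst s $ 3) X < 0" by simp_all
qed

lemma eventually_less_linear:
  fixes h m :: real
  shows "(\<forall>\<^sub>F t in at_top. h < m * t) \<longleftrightarrow> m > 0 \<or> m = 0 \<and> h < 0"
proof (cases m "0 :: real" rule: linorder_cases)
  case greater
  have "\<forall>\<^sub>F t in at_top. h / m < t" by (rule eventually_gt_at_top)
  then have "\<forall>\<^sub>F t in at_top. h < m * t"
    by (rule eventually_mono) (use greater in \<open>simp add: pos_divide_less_eq mult.commute\<close>)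
  then show ?thesis using greater by simp
next
  case less
  have "\<not> (\<forall>\<^sub>F t in at_top. h < m * t)"
  proof
    assume "\<forall>\<^sub>F t in at_top. h < m * t"
    then have "\<forall>\<^sub>F t in at_top. h < m * t \<and> h / m < t"
      by (rule eventually_conj) (rule eventually_gt_at_top)
    then obtain t where "h < m * t" "h / m < t" using eventually_happens by fastforce
    then show False using less by (simp add: neg_divide_less_eq mult.commute)
  qed
  then show ?thesis using less by simp
qed simp

text \<open>The outer normal, of squared length \<open>2\<close>, of a leg rising with slope angle \<open>\<beta>\<close>.\<close>

lemma leg_normal:
  fixes x y :: real
  assumes "x\<^sup>2 + y\<^sup>2 = 2" "x * a + y * b = 0" "a > 0" "b * cos \<beta> = a * sin \<beta>" "x < 0" "sin \<beta> > 0"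
  shows "x = - sqrt 2 * sin \<beta>" "y = sqrt 2 * cos \<beta>"
proof -
  have "a * (x * cos \<beta> + y * sin \<beta>) = cos \<beta> * (x * a + y * b)" using assms(4) by algebra
  then have 0: "x * cos \<beta> = - y * sin \<beta>" using assms(2,3) by simp
  have "x\<^sup>2 = (sqrt 2 * sin \<beta>)\<^sup>2"
  proof -
    have "x\<^sup>2 * (cos \<beta>)\<^sup>2 = y\<^sup>2 * (sin \<beta>)\<^sup>2" using 0 by algebra
    then have "x\<^sup>2 = 2 * (sin \<beta>)\<^sup>2" using assms(1) sin_cos_squared_add[of \<beta>] by algebra
    then show ?thesis by (simp add: power_mult_distrib)
  qed
  then have "x = sqrt 2 * sin \<beta> \<or> x = - (sqrt 2 * sin \<beta>)" by (simp add: power2_eq_iff)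
  moreover have "sqrt 2 * sin \<beta> > 0" using assms(6) by simp
  ultimately show x: "x = - sqrt 2 * sin \<beta>" using assms(5) by auto
  have "sin \<beta> * y = sin \<beta> * (sqrt 2 * cos \<beta>)" using 0 unfolding x by auto
  then show "y = sqrt 2 * cos \<beta>" using assms(6) by simp
qed

theorem corollary6p10:
  fixes n :: nat and \<alpha> :: real and X Y Z F G :: "real^2" and s\<^sub>0 :: labelled_seed
    and \<Gamma>V :: "seed set" and \<Gamma>E :: "(seed \<times> seed) set" and L :: "(real^2) set"
  assumes "n \<ge> 1"
    and "\<alpha> = pi / (2 * real n + 1)"
    and "initial_triangle n \<alpha> X Y Z"
    and "initial_seed X Y Z s\<^sub>0"
    and "altitude_foot F Z X Y"
    and "altitude_foot G X Y Z"
  defines "\<Gamma>V \<equiv> exchange_vertices (positive_towards F G) s\<^sub>0"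
    and "\<Gamma>E \<equiv> exchange_edges (positive_towards F G) s\<^sub>0"
    and "L \<equiv> translation_lattice (positive_towards F G) s\<^sub>0"
  shows "(\<exists>S. finite_symmetric_generators S L) \<and>
    (\<forall>S. finite_symmetric_generators S L \<longrightarrow>
      quasi_isometry L (graph_dist (cayley_edges L S)) \<Gamma>V (graph_dist \<Gamma>E)
        (\<lambda>w. translate_seed w (seed_of s\<^sub>0)))"
proof -
  define \<beta> where "\<beta> = real n * \<alpha>"
  have \<alpha>pos: "\<alpha> > 0" unfolding assms(2) by (simp add: add_nonneg_pos)
  have \<beta>2: "2 * \<beta> = pi - \<alpha>"
  proof -
    have "(2 * real n + 1) * \<alpha> = pi" unfolding assms(2) by (simp add: add_nonneg_eq_0_iff)
    then show ?thesis by (simp add: \<beta>_def algebra_simps)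
  qed
  have \<alpha>\<beta>: "\<alpha> \<le> \<beta>" using mult_right_mono[of 1 "real n" \<alpha>] assms(1) \<alpha>pos by (simp add: \<beta>_def)
  have \<beta>: "0 < \<beta>" "\<beta> < pi / 2" "\<alpha> < pi / 2" using \<beta>2 \<alpha>pos \<alpha>\<beta> by linarith+
  have sc: "sin \<alpha> > 0" "cos \<alpha> > 0" "sin \<beta> > 0" "cos \<beta> > 0"
    using \<beta> \<alpha>pos by (auto intro!: sin_gt_zero cos_gt_zero)
  have dbl: "cos (2 * \<beta>) = - cos \<alpha>" "sin (2 * \<beta>) = sin \<alpha>" unfolding \<beta>2 by simp_all
  have tri: "\<not> collinear {X, Y, Z}" and ang: "angle_at X Y Z = \<beta>" "angle_at Y X Z = \<beta>"
    using assms(3) by (simp_all add: initial_triangle_def \<beta>_def)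
  obtain u w :: "real^2" and a b :: real where o: "u \<bullet> u = 1" "w \<bullet> w = 1" "u \<bullet> w = 0"
    and expand': "\<forall>x y. x \<bullet> y = (x \<bullet> u) * (y \<bullet> u) + (x \<bullet> w) * (y \<bullet> w)"
    and ab: "a > 0" "b > 0" "b * cos \<beta> = a * sin \<beta>"
    and pts: "Y = X + (2 * a) *\<^sub>R u" "Z = X + a *\<^sub>R u + b *\<^sub>R w" "F = X + a *\<^sub>R u"
    and G: "G = F + a *\<^sub>R (- cos (2 * \<beta>) *\<^sub>R u + sin (2 * \<beta>) *\<^sub>R w)"
    by (rule isosceles_frame[OF tri ang \<beta>(1,2) assms(5,6)])
  have expand: "x \<bullet> y = (x \<bullet> u) * (y \<bullet> u) + (x \<bullet> w) * (y \<bullet> w)" for x y using expand' by blast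
  have wu: "w \<bullet> u = 0" using o by (simp add: inner_commute)
  define d where "d = cos \<alpha> *\<^sub>R u + sin \<alpha> *\<^sub>R w"
  define e where "e = - sin \<alpha> *\<^sub>R u + cos \<alpha> *\<^sub>R w"
  \<comment> \<open>The value for which \<open>\<omega>(v\<^sub>1, v\<^sub>2) = b\<^sub>1\<^sub>2\<close>.\<close>
  define \<kappa> where "\<kappa> = 2 * cos \<beta> / (sin \<alpha> * (sqrt 2 * a * sin \<beta>))"
  have GF: "G - F = a *\<^sub>R d" unfolding G dbl d_def by simp
  have xd: "x \<bullet> d = cos \<alpha> * (x \<bullet> u) + sin \<alpha> * (x \<bullet> w)"
    and xe: "x \<bullet> e = cos \<alpha> * (x \<bullet> w) - sin \<alpha> * (x \<bullet> u)" for x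
    by (simp_all add: d_def e_def inner_add_right inner_diff_right)
  interpret belt F d e \<kappa> \<alpha> n
  proof
    show "d \<bullet> d = 1" "e \<bullet> e = 1" "d \<bullet> e = 0"
      unfolding xd xe unfolding d_def e_def using o wu sin_cos_squared_add[of \<alpha>]
      by (simp_all add: inner_add_left inner_diff_left power2_eq_square)
    show "x \<bullet> y = (x \<bullet> d) * (y \<bullet> d) + (x \<bullet> e) * (y \<bullet> e)" for x y
      unfolding xd xe expand[of x y] using sin_cos_squared_add[of \<alpha>] by algebra
    show "\<kappa> \<noteq> 0" using sc ab by (simp add: \<kappa>_def)
    show "\<alpha> = pi / (2 * real n + 1)" by (rule assms(2))
  qed
  have pos: "positive_towards F G = positive"
  proof
    fix f
    have line: "F + t *\<^sub>R (G - F) \<in> half_plane f \<longleftrightarrow> height f - (a * sqrt 2 * sine f) * t < 0" for t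
      unfolding half_plane_def mem_Collect_eq aeval_add GF by (simp add: height_def sine_def algebra_simps)
    have "(\<forall>\<^sub>F t in at_top. height f < (a * sqrt 2 * sine f) * t) \<longleftrightarrow> positive f"
      unfolding positive_def eventually_less_linear
      using ab(1) by (auto simp: zero_less_mult_iff mult_less_0_iff)
    then show "positive_towards F G f = positive f"
      unfolding positive_towards_def line by simp
  qed
  define v where "v = fst s\<^sub>0"
  note sides = initial_seed_sides[OF assms(4) tri, folded v_def]
  have unit: "(fst (v $ i) \<bullet> u)\<^sup>2 + (fst (v $ i) \<bullet> w)\<^sup>2 = 2" for i
  proof -
    have "form (v $ i) (v $ i) = 2"
      using assms(4) by (simp add: initial_seed_def is_labelled_seed_def geometric_realisation_def v_def)
    then show ?thesis unfolding form_def expand[of "fst (v $ i)" "fst (v $ i)"] by (simp add: power2_eq_square)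
  qed
  have g1: "fst (v $ 1) \<bullet> u = 0" "fst (v $ 1) \<bullet> w = - sqrt 2"
  proof -
    show 0: "fst (v $ 1) \<bullet> u = 0" using sides(1,2) ab(1) by (simp add: pts aeval_add)
    have "(fst (v $ 1) \<bullet> w) * b < 0"
      using sides(1,3) 0 by (simp add: pts aeval_add inner_add_right mult.commute)
    then have "fst (v $ 1) \<bullet> w < 0" using ab(2) by (simp add: mult_less_0_iff)
    moreover have "(fst (v $ 1) \<bullet> w)\<^sup>2 = (sqrt 2)\<^sup>2" using unit[of 1] 0 by simp
    ultimately show "fst (v $ 1) \<bullet> w = - sqrt 2" using power2_eq_iff by fastforce
  qed
  have g2: "fst (v $ 2) \<bullet> u = - sqrt 2 * sin \<beta>" "fst (v $ 2) \<bullet> w = sqrt 2 * cos \<beta>"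
  proof -
    have "fst (v $ 2) \<bullet> u < 0" using sides(4,6) ab(1) by (simp add: pts aeval_add mult_less_0_iff)
    moreover have "(fst (v $ 2) \<bullet> u) * a + (fst (v $ 2) \<bullet> w) * b = 0"
      using sides(4,5) by (simp add: pts aeval_add inner_add_right mult.commute)
    ultimately show "fst (v $ 2) \<bullet> u = - sqrt 2 * sin \<beta>" "fst (v $ 2) \<bullet> w = sqrt 2 * cos \<beta>"
      using leg_normal[OF unit _ ab(1,3) _ sc(3)] by blast+
  qed
  have g3: "fst (v $ 3) \<bullet> u = sqrt 2 * sin \<beta>" "fst (v $ 3) \<bullet> w = sqrt 2 * cos \<beta>"
  proof -
    have YX: "aeval (v $ 3) Y = aeval (v $ 3) X + 2 * a * (fst (v $ 3) \<bullet> u)" by (simp add: pts(1) aeval_add)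
    then have "0 < 2 * a * (fst (v $ 3) \<bullet> u)" using sides(7,9) by linarith
    then have neg: "- (fst (v $ 3) \<bullet> u) < 0" using ab(1) by (simp add: zero_less_mult_iff)
    have "aeval (v $ 3) Z = aeval (v $ 3) X + a * (fst (v $ 3) \<bullet> u) + b * (fst (v $ 3) \<bullet> w)"
      by (simp add: pts(2) aeval_add)
    then have eq: "- (fst (v $ 3) \<bullet> u) * a + (fst (v $ 3) \<bullet> w) * b = 0"
      using YX sides(7,8) by (simp add: algebra_simps)
    have un: "(- (fst (v $ 3) \<bullet> u))\<^sup>2 + (fst (v $ 3) \<bullet> w)\<^sup>2 = 2" using unit[of 3] by simp
    show "fst (v $ 3) \<bullet> u = sqrt 2 * sin \<beta>" "fst (v $ 3) \<bullet> w = sqrt 2 * cos \<beta>"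
      using leg_normal[OF un eq ab(1,3) neg sc(3)] by simp_all
  qed
  have sum\<beta>: "\<alpha> + \<beta> = pi - \<beta>" using \<beta>2 by simp
  \<comment> \<open>The sides \<open>XY\<close>, \<open>XZ\<close>, \<open>YZ\<close> have the angles \<open>\<pi> - \<alpha>\<close>, \<open>\<beta> - \<alpha>\<close> and \<open>\<beta> + \<pi>\<close>.\<close>
  have c1: "sine (v $ 1) = sin \<alpha>" "cosine (v $ 1) = - cos \<alpha>"
    by (simp_all add: sine_def cosine_def xd xe g1)
  have c2: "sine (v $ 2) = sin (\<beta> - \<alpha>)" "cosine (v $ 2) = cos (\<beta> - \<alpha>)"
    by (simp_all add: sine_def cosine_def xd xe g2 sin_diff cos_diff field_simps)
  have c3: "sine (v $ 3) = - sin \<beta>" "cosine (v $ 3) = - cos \<beta>"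
  proof -
    have "sine (v $ 3) = - sin (\<alpha> + \<beta>)" "cosine (v $ 3) = cos (\<alpha> + \<beta>)"
      by (simp_all add: sine_def cosine_def xd xe g3 sin_add cos_add field_simps)
    then show "sine (v $ 3) = - sin \<beta>" "cosine (v $ 3) = - cos \<beta>" unfolding sum\<beta> by simp_all
  qed
  have h: "height (v $ 1) = 0" "height (v $ 2) = - (sqrt 2 * a * sin \<beta>)" "height (v $ 3) = - (sqrt 2 * a * sin \<beta>)"
  proof -
    have F: "height f = aeval f X + a * (fst f \<bullet> u)"
      and Y: "aeval f Y = aeval f X + 2 * (a * (fst f \<bullet> u))" for f
      unfolding height_def by (simp_all add: pts aeval_add)
    show "height (v $ 1) = 0" unfolding F g1 sides(1) by simp
    show "height (v $ 2) = - (sqrt 2 * a * sin \<beta>)" unfolding F g2 sides(4) by simp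
    have "height (v $ 3) = - (a * (fst (v $ 3) \<bullet> u))"
      using F[of "v $ 3"] Y[of "v $ 3"] sides(7) by linarith
    then show "height (v $ 3) = - (sqrt 2 * a * sin \<beta>)" unfolding g3 by simp
  qed
  have half: "2 * (sin \<beta> * cos \<beta>) = sin \<alpha>" "2 * (cos \<beta>)\<^sup>2 = 1 - cos \<alpha>"
    using dbl by (simp_all add: sin_double cos_double_cos)
  have trig: "2 * cos \<beta> * (sin \<beta> + sin (\<beta> - \<alpha>)) = 2 * cos \<alpha> * sin \<alpha>"
  proof -
    have "2 * cos \<beta> * (sin \<beta> + sin (\<beta> - \<alpha>)) =
        (2 * (sin \<beta> * cos \<beta>)) * (1 + cos \<alpha>) - (2 * (cos \<beta>)\<^sup>2) * sin \<alpha>"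
      by (simp add: sin_diff algebra_simps power2_eq_square)
    also have "\<dots> = 2 * cos \<alpha> * sin \<alpha>" unfolding half by (simp add: algebra_simps)
    finally show ?thesis .
  qed
  have sk: "skew (v $ 1) (v $ 2) = 2 * cos \<beta>" "skew (v $ 1) (v $ 3) = 2 * cos \<beta>"
    "skew (v $ 2) (v $ 3) = 2 * cos \<alpha>"
  proof -
    define K where "K = sqrt 2 * a * sin \<beta>"
    have K: "K \<noteq> 0" using ab sc by (simp add: K_def)
    have hK: "height (v $ 2) = - K" "height (v $ 3) = - K" "\<kappa> = 2 * cos \<beta> / (sin \<alpha> * K)"
      by (simp_all add: h \<kappa>_def K_def)
    show "skew (v $ 1) (v $ 2) = 2 * cos \<beta>" "skew (v $ 1) (v $ 3) = 2 * cos \<beta>"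
      unfolding skew_def c1 h(1) hK(1,2) unfolding hK(3) using K sc by simp_all
    have "skew (v $ 2) (v $ 3) = \<kappa> * K * (sin \<beta> + sin (\<beta> - \<alpha>))"
      unfolding skew_def c2 c3 hK(1,2) by (simp add: algebra_simps)
    also have "\<dots> = 2 * cos \<beta> * (sin \<beta> + sin (\<beta> - \<alpha>)) / sin \<alpha>" using K by (simp add: hK)
    also have "\<dots> = 2 * cos \<alpha>" unfolding trig using sc by simp
    finally show "skew (v $ 2) (v $ 3) = 2 * cos \<alpha>" .
  qed
  have fm: "form (v $ 1) (v $ 2) = - 2 * cos \<beta>" "form (v $ 1) (v $ 3) = - 2 * cos \<beta>"
    "form (v $ 2) (v $ 3) = - 2 * cos \<alpha>"
  proof -
    have "form (v $ 1) (v $ 2) = - 2 * cos (\<alpha> + (\<beta> - \<alpha>))"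
      unfolding form_coords c1 c2 cos_add by simp
    then show "form (v $ 1) (v $ 2) = - 2 * cos \<beta>" by simp
    have "form (v $ 1) (v $ 3) = 2 * cos (\<alpha> + \<beta>)" unfolding form_coords c1 c3 cos_add by simp
    then show "form (v $ 1) (v $ 3) = - 2 * cos \<beta>" unfolding sum\<beta> by simp
    have "form (v $ 2) (v $ 3) = - 2 * cos (\<beta> - (\<beta> - \<alpha>))"
      unfolding form_coords c2 c3 cos_diff[of \<beta> "\<beta> - \<alpha>"] by simp
    then show "form (v $ 2) (v $ 3) = - 2 * cos \<alpha>" by simp
  qed
  have "compatible s\<^sub>0"
  proof -
    define B where "B = snd s\<^sub>0"
    have tr: "transpose B = - B" and absB: "\<And>i j. i \<noteq> j \<Longrightarrow> \<bar>form (v $ i) (v $ j)\<bar> = \<bar>B $ i $ j\<bar>"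
      and Bpos: "B $ 1 $ 2 > 0" "B $ 1 $ 3 > 0" "B $ 2 $ 3 > 0"
      using assms(4) by (simp_all add: initial_seed_def is_labelled_seed_def exchange_matrix_def
          geometric_realisation_def v_def B_def)
    have skB: "B $ j $ i = - (B $ i $ j)" for i j
    proof -
      have "B $ j $ i = transpose B $ i $ j" by (simp add: transpose_def)
      then show ?thesis unfolding tr by simp
    qed
    have Bv: "B $ 1 $ 2 = 2 * cos \<beta>" "B $ 1 $ 3 = 2 * cos \<beta>" "B $ 2 $ 3 = 2 * cos \<alpha>"
      using absB[of 1 2] absB[of 1 3] absB[of 2 3] Bpos sc by (auto simp: fm)
    have diag: "B $ i $ i = 0" for i using skB[of i i] by simp
    show ?thesis unfolding compatible_def v_def[symmetric] B_def[symmetric]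
      using sk Bv skB[of 1 2] skB[of 1 3] skB[of 2 3] diag
        skew_swap[of "v $ 2" "v $ 1"] skew_swap[of "v $ 3" "v $ 1"] skew_swap[of "v $ 3" "v $ 2"]
      by (simp add: forall_3)
  qed
  \<comment> \<open>The exceptional order runs from the sink \<open>YZ\<close> to the source \<open>XY\<close>.\<close>
  moreover have "exceptional (v $ 3) (v $ 2) (v $ 1)"
    unfolding exceptional_def
  proof (intro conjI)
    show "root (v $ 1)" unfolding root_def c1
    proof (intro exI[of _ "2 * int n"])
      have arg: "real_of_int (2 * int n) * \<alpha> = pi - \<alpha>" using \<beta>2 by (simp add: \<beta>_def)
      show "- cos \<alpha> = cos (real_of_int (2 * int n) * \<alpha>) \<and> sin \<alpha> = sin (real_of_int (2 * int n) * \<alpha>)"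
        unfolding arg by simp
    qed
    show "root (v $ 2)" unfolding root_def c2
      by (intro exI[of _ "int n - 1"]) (simp add: \<beta>_def left_diff_distrib)
    show "root (v $ 3)" unfolding root_def c3
    proof (intro exI[of _ "3 * int n + 1"])
      have arg: "real_of_int (3 * int n + 1) * \<alpha> = \<beta> + pi" using \<beta>2 by (simp add: \<beta>_def algebra_simps)
      show "- cos \<beta> = cos (real_of_int (3 * int n + 1) * \<alpha>) \<and>
          - sin \<beta> = sin (real_of_int (3 * int n + 1) * \<alpha>)"
        unfolding arg by simp
    qed
    show "ordered (v $ 3) (v $ 2)" "ordered (v $ 3) (v $ 1)" "ordered (v $ 2) (v $ 1)"
      unfolding ordered_def skew_swap[of "v $ 3"] skew_swap[of "v $ 2" "v $ 1"]
        form_commute[of "v $ 3"] form_commute[of "v $ 2" "v $ 1"] sk fm by simp_all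
    show "positive (- (v $ 3))" "positive (v $ 1)" "sine (v $ 3) \<noteq> 0 \<or> sine (v $ 1) \<noteq> 0"
      using sc by (auto simp: positive_def coord_simps c1 c3)
    show "balanced (v $ 3) (v $ 2) (v $ 1)" unfolding balanced_def
      by (intro exI[of _ "-1"]) (use sc in \<open>simp add: c1 c2 c3 sin_diff cos_diff\<close>)
  qed
  ultimately have "belt_seed s\<^sub>0"
    unfolding belt_seed_def v_def by (intro conjI exI[of _ 3] exI[of _ 2] exI[of _ 1]) auto
  then show ?thesis unfolding \<Gamma>V_def \<Gamma>E_def L_def pos by (rule exchange_graph_quasi_isometric)
qed

end
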